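(* Let $s\in(0,1)$, $0<\lambda\le\Lambda$, and let $\Omega\subset\mathbb{R}^n$ be any open set. Assume there are $x_0\in B_{1/2}$ and $\varrho>0$ such that $B_{2\varrho}(x_0)\subset\Omega\cap B_{1/2}$. Then there exists $\delta>0$, depending only on $n,s,\varrho,\lambda,\Lambda$, such that the following holds. Let $u_1,u_2\in C(B_1)$ satisfy, in the viscosity sense, \[M^+(au_1+bu_2)\ge-\delta(|a|+|b|)\ \text{ in } B_1\cap\Omega\quad\text{for all } a,b\in\mathbb{R},\qquad u_1=u_2=0\ \text{ in } B_1\setminus\Omega,\] and \[u_i\ge0 \text{ in }\mathbb{R}^n,\qquad \int_{\mathbb{R}^n}\frac{u_i(x)}{1+|x|^{n+2s}}\,dx=1,\quad i=1,2.\] Then $C^{-1}u_2\le u_1\le Cu_2$ in $B_{1/2}$, with $C$ depending only on $n,s,\varrho,\lambda,\Lambda$.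
   Context: $B_r(x)$ denotes the open ball of radius $r$ centered at $x$, and $B_r=B_r(0)$. $\mathcal L_0$ denotes the class of all linear operators $Lu(x)=\int_{\mathbb{R}^n}\left(\frac{u(x+y)+u(x-y)}{2}-u(x)\right)K(y)\,dy$ with kernels satisfying $K(y)=K(-y)$ and $\frac{\lambda}{|y|^{n+2s}}\le K(y)\le\frac{\Lambda}{|y|^{n+2s}}$ for all $y\in\mathbb{R}^n$. The extremal operators are $M^+u=\sup_{L\in\mathcal L_0}Lu$ and $M^-u=\inf_{L\in\mathcal L_0}Lu$. Inequalities involving $M^\pm$ are understood in the viscosity sense. *)

theory Defs
  imports "HOL-Analysis.Analysis"
begin

definition C2_on :: "'a::euclidean_space set \<Rightarrow> ('a \<Rightarrow> real) \<Rightarrow> bool" where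
  "C2_on U \<phi> \<longleftrightarrow> (\<exists>D :: 'a \<Rightarrow> 'a \<Rightarrow>\<^sub>L real. \<exists>D2 :: 'a \<Rightarrow> 'a \<Rightarrow>\<^sub>L ('a \<Rightarrow>\<^sub>L real).
      (\<forall>z\<in>U. (\<phi> has_derivative blinfun_apply (D z)) (at z)) \<and>
      (\<forall>z\<in>U. (D has_derivative blinfun_apply (D2 z)) (at z)) \<and>
      continuous_on U D2)"

definition kernels :: "real \<Rightarrow> real \<Rightarrow> real \<Rightarrow> ('a::euclidean_space \<Rightarrow> real) set" where
  "kernels lam Lam s = {K. K \<in> borel_measurable lebesgue \<and> (\<forall>y. K (-y) = K y) \<and>
      (\<forall>y. y \<noteq> 0 \<longrightarrow> lam / norm y powr (real DIM('a) + 2 * s) \<le> K y \<and>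
                     K y \<le> Lam / norm y powr (real DIM('a) + 2 * s))}"

definition Lop :: "('a::euclidean_space \<Rightarrow> real) \<Rightarrow> ('a \<Rightarrow> real) \<Rightarrow> 'a \<Rightarrow> real" where
  "Lop K u x = (LINT y|lebesgue. ((u (x + y) + u (x - y)) / 2 - u x) * K y)"

definition Mplus :: "real \<Rightarrow> real \<Rightarrow> real \<Rightarrow> ('a::euclidean_space \<Rightarrow> real) \<Rightarrow> 'a \<Rightarrow> ereal" where
  "Mplus lam Lam s u x = (SUP K \<in> kernels lam Lam s. ereal (Lop K u x))"

text \<open>Viscosity sense of  M^+ u \<ge> f  in D (Caffarelli--Silvestre): whenever a C^2 function
  touches u from above at x in a neighbourhood N of x in D, the function equal to the test
  function in N and to u outside N satisfies the inequality pointwise at x.\<close>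
definition visc_sub_Mplus ::
  "real \<Rightarrow> real \<Rightarrow> real \<Rightarrow> 'a::euclidean_space set \<Rightarrow> ('a \<Rightarrow> real) \<Rightarrow> ('a \<Rightarrow> real) \<Rightarrow> bool" where
  "visc_sub_Mplus lam Lam s D u f \<longleftrightarrow>
     (\<forall>x N U \<phi>. x \<in> D \<and> open N \<and> x \<in> N \<and> N \<subseteq> D \<and> open U \<and> closure N \<subseteq> U \<and>
        C2_on U \<phi> \<and> \<phi> x = u x \<and> (\<forall>y\<in>N - {x}. \<phi> y > u y) \<longrightarrow>
        Mplus lam Lam s (\<lambda>y. if y \<in> N then \<phi> y else u y) x \<ge> ereal (f x))"

end

theory Submission
  imports Defs
begin

text \<open>
  Every estimate comes from one test: if a paraboloid touches \<open>u\<close> from above at an interior point,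
  the viscosity inequality bounds the right-hand side by the integral of any integrable majorant of
  the integrands of all admissible \<open>L\<close>. Because the kernels have full support with a lower bound,
  this replaces the ABP and \<open>L\<^sup>\<epsilon>\<close> machinery.

  Upper bound: at a maximum point of \<open>u x * (R\<^sup>2 - |x|\<^sup>2) ^ n\<close> a large value of \<open>u\<close> cannot persist in a
  small ball, since \<open>u\<close> has unit weighted mass, and the nonlocal drop then contradicts \<open>M\<^sup>+ u \<ge> -\<delta>\<close>.
  Lower bound: slide a small paraboloid under \<open>u\<close> inside the ball of radius \<open>2\<rho>\<close>; at the contact point
  the unit mass of \<open>u\<close> contradicts \<open>M\<^sup>- u \<le> \<delta>\<close>.
  Comparison: if \<open>u\<^sub>1 - C u\<^sub>2\<close> is positive at \<open>z\<close>, a maximum point of \<open>u\<^sub>1 - C u\<^sub>2 - K |x - z|\<^sup>2\<close> lies in \<open>\<Omega>\<close>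
  near \<open>z\<close>. There the very negative values of \<open>u\<^sub>1 - C u\<^sub>2\<close> on the ball around \<open>x\<^sub>0\<close> outweigh all bounded
  contributions, whatever the regularity of \<open>\<Omega>\<close>.
\<close>

subsection \<open>Integrals of the kernel\<close>

text \<open>Such a map scales volume by \<open>\<bar>c\<bar> ^ DIM('a)\<close>, which is 1, so the
  density in the change of variables is trivial. It is used with \<open>c = 1\<close> and
  \<open>c = -1\<close>, for the two halves of a second difference.\<close>

lemma lebesgue_isometric_affine:
  fixes x :: "'a::euclidean_space" and c :: real
  assumes "\<bar>c\<bar> = 1"
  shows "(\<lambda>y. x + c *\<^sub>R y) \<in> lebesgue \<rightarrow>\<^sub>M lebesgue"
    and "distr lebesgue lebesgue (\<lambda>y. x + c *\<^sub>R y) = lebesgue"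
proof -
  have eq: "(\<lambda>y. x + (\<Sum>j\<in>Basis. (c * (y \<bullet> j)) *\<^sub>R j)) = (\<lambda>y. x + c *\<^sub>R y)"
    unfolding scaleR_scaleR[symmetric] scaleR_sum_right[symmetric] euclidean_representation ..
  have c0: "\<And>j :: 'a. j \<in> Basis \<Longrightarrow> c \<noteq> 0" using assms by auto
  show "(\<lambda>y. x + c *\<^sub>R y) \<in> lebesgue \<rightarrow>\<^sub>M lebesgue"
    using lebesgue_affine_measurable[of "\<lambda>_. c" x, OF c0] unfolding eq by simp
  show "distr lebesgue lebesgue (\<lambda>y. x + c *\<^sub>R y) = lebesgue"
    using lebesgue_affine_euclidean[of "\<lambda>_. c" x, OF c0] assms unfolding eq
    by (simp add: density_1)
qed

lemma integral_isometric_affine: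
  fixes x :: "'a::euclidean_space" and c :: real and f :: "'a \<Rightarrow> real"
  assumes c: "\<bar>c\<bar> = 1" and f: "f \<in> borel_measurable lebesgue"
  shows "(\<lambda>y. f (x + c *\<^sub>R y)) \<in> borel_measurable lebesgue"
    and "integrable lebesgue (\<lambda>y. f (x + c *\<^sub>R y)) \<longleftrightarrow> integrable lebesgue f"
    and "(LINT y|lebesgue. f (x + c *\<^sub>R y)) = (LINT y|lebesgue. f y)"
proof -
  note m = lebesgue_isometric_affine[OF c, of x]
  show "(\<lambda>y. f (x + c *\<^sub>R y)) \<in> borel_measurable lebesgue"
    by (rule measurable_compose[OF m(1) f])
  show "integrable lebesgue (\<lambda>y. f (x + c *\<^sub>R y)) \<longleftrightarrow> integrable lebesgue f"
    using integrable_distr_eq[OF m(1) f] m(2) by simp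
  show "(LINT y|lebesgue. f (x + c *\<^sub>R y)) = (LINT y|lebesgue. f y)"
    using integral_distr[OF m(1) f] m(2) by simp
qed

lemmas lebesgue_integral_translate = integral_isometric_affine[where c = 1, simplified]
lemmas lebesgue_integral_reflect = integral_isometric_affine[where c = "-1", simplified]

text \<open>Translation and reflection both preserve the integral. Applied to the weighted function,
  this says that the values at \<open>x + y\<close> and \<open>x - y\<close>, averaged as in a
  second difference at \<open>x\<close>, still carry the full unit mass.\<close>

lemma integral_symmetric_mean:
  fixes x :: "'a::euclidean_space" and f :: "'a \<Rightarrow> real"
  assumes "integrable lebesgue f"
  shows "integrable lebesgue (\<lambda>y. (f (x + y) + f (x - y)) / 2)"
    and "(LINT y|lebesgue. (f (x + y) + f (x - y)) / 2) = (LINT y|lebesgue. f y)"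
proof -
  have m: "f \<in> borel_measurable lebesgue" using assms by auto
  have "integrable lebesgue (\<lambda>y. f (x + y))" "integrable lebesgue (\<lambda>y. f (x - y))"
    using lebesgue_integral_translate(2)[OF m] lebesgue_integral_reflect(2)[OF m] assms by auto
  then show "integrable lebesgue (\<lambda>y. (f (x + y) + f (x - y)) / 2)"
    "(LINT y|lebesgue. (f (x + y) + f (x - y)) / 2) = (LINT y|lebesgue. f y)"
    using lebesgue_integral_translate(3)[OF m, of x] lebesgue_integral_reflect(3)[OF m, of x] by auto
qed

lemma borel_measurable_lebesgueI:
  "f \<in> borel_measurable borel \<Longrightarrow> f \<in> borel_measurable lebesgue"
  by (simp add: measurable_completion)

lemma emeasure_lebesgue_ball:
  fixes c :: "'a::euclidean_space"
  assumes "0 \<le> r"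
  shows "emeasure lebesgue (ball c r) = ennreal (unit_ball_vol (DIM('a)) * r ^ DIM('a))"
  using emeasure_ball[OF assms, of c] by simp

lemma integral_indicator_ball:
  fixes c :: "'a::euclidean_space"
  assumes "0 \<le> r"
  shows "integrable lebesgue (indicator (ball c r) :: 'a \<Rightarrow> real)"
    and "(LINT y|lebesgue. indicator (ball c r) y :: real) = unit_ball_vol (DIM('a)) * r ^ DIM('a)"
proof -
  show "integrable lebesgue (indicator (ball c r) :: 'a \<Rightarrow> real)"
    using emeasure_lebesgue_ball[OF assms, of c] by (intro integrable_real_indicator) auto
  show "(LINT y|lebesgue. indicator (ball c r) y :: real) = unit_ball_vol (DIM('a)) * r ^ DIM('a)"
    using emeasure_lebesgue_ball[OF assms, of c] assms by (simp add: measure_def)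
qed

section \<open>Dyadic estimates for the singular part and the tail of the kernel\<close>

text \<open>By \<open>cover\<close>, \<open>f\<close> lies below the sum of \<open>a k\<close> times
  the indicator of the ball of radius \<open>R k\<close>, and this sum is integrated term by term in
  the nonnegative extended integral. With dyadic radii it serves the singularity at the origin and
  the tail at infinity alike.\<close>

lemma integral_le_sum_over_balls:
  fixes f :: "'a::euclidean_space \<Rightarrow> real" and a R :: "nat \<Rightarrow> real"
  assumes f: "f \<in> borel_measurable lebesgue" "\<And>y. 0 \<le> f y"
    and a: "\<And>k. 0 \<le> a k" and R: "\<And>k. 0 \<le> R k"
    and S: "(\<lambda>k. a k * R k ^ DIM('a)) sums S"
    and cover: "\<And>y. 0 < f y \<Longrightarrow> \<exists>k. norm y < R k \<and> f y \<le> a k"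
  shows "integrable lebesgue f"
    and "(LINT y|lebesgue. f y) \<le> unit_ball_vol (DIM('a)) * S"
proof -
  let ?V = "unit_ball_vol (DIM('a))"
  have S': "(\<lambda>k. a k * (?V * R k ^ DIM('a))) sums (?V * S)"
    using sums_mult[OF S, of ?V] by (simp add: ac_simps)
  have S0: "0 \<le> ?V * S"
    using S a R by (intro mult_nonneg_nonneg sums_le[OF _ sums_zero S]) auto
  have "(\<integral>\<^sup>+y. ennreal (f y) \<partial>lebesgue)
      \<le> (\<integral>\<^sup>+(y::'a). (\<Sum>k. ennreal (a k) * indicator (ball 0 (R k)) y) \<partial>lebesgue)"
  proof (rule nn_integral_mono)
    fix y :: 'a
    show "ennreal (f y) \<le> (\<Sum>k. ennreal (a k) * indicator (ball 0 (R k)) y)"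
    proof (cases "0 < f y")
      case True
      then obtain k where k: "norm y < R k" "f y \<le> a k" using cover by blast
      have "ennreal (f y) \<le> (\<Sum>i\<in>{k}. ennreal (a i) * indicator (ball 0 (R i)) y)"
        using k by (simp add: ennreal_leI)
      also have "\<dots> \<le> (\<Sum>k. ennreal (a k) * indicator (ball 0 (R k)) y)"
        by (rule sum_le_suminf) auto
      finally show ?thesis .
    next
      case False
      then show ?thesis using f(2)[of y] by (simp add: not_less)
    qed
  qed
  also have "\<dots> = (\<Sum>k. ennreal (a k * (?V * R k ^ DIM('a))))"
  proof (subst nn_integral_suminf)
    fix i
    have b: "ball (0::'a) (R i) \<in> sets lebesgue" by simp
    then show "(\<lambda>y. ennreal (a i) * indicator (ball 0 (R i)) y) \<in> borel_measurable lebesgue"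
      by (intro borel_measurable_times_ennreal borel_measurable_indicator) auto
  next
    have b: "ball (0::'a) (R i) \<in> sets lebesgue" for i by simp
    have "(\<integral>\<^sup>+(y::'a). ennreal (a i) * indicator (ball 0 (R i)) y \<partial>lebesgue)
        = ennreal (a i * (?V * R i ^ DIM('a)))" for i
      unfolding nn_integral_cmult_indicator[OF b] emeasure_lebesgue_ball[OF R]
      using a R by (simp add: ennreal_mult)
    then show "(\<Sum>i. \<integral>\<^sup>+(y::'a). ennreal (a i) * indicator (ball 0 (R i)) y \<partial>lebesgue)
        = (\<Sum>k. ennreal (a k * (?V * R k ^ DIM('a))))" by simp
  qed
  also have "\<dots> = ennreal (?V * S)"
    using S' a R by (subst suminf_ennreal2) (auto simp: sums_iff)
  finally have le: "(\<integral>\<^sup>+y. ennreal (f y) \<partial>lebesgue) \<le> ennreal (?V * S)" .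
  then show "integrable lebesgue f"
    using f by (intro integrableI_nonneg) (auto simp: less_top[symmetric] top_unique)
  show "(LINT y|lebesgue. f y) \<le> ?V * S"
    by (rule integral_real_bounded[OF S0 le])
qed

lemma power_bracket_below:
  fixes t R :: real
  assumes "0 < t" "t < R"
  shows "\<exists>k::nat. R / 2 ^ Suc k \<le> t \<and> t < R / 2 ^ k"
proof -
  define k where "k = (LEAST k::nat. R / 2 ^ k \<le> t)"
  have ex: "\<exists>k::nat. R / 2 ^ k \<le> t"
    using real_arch_pow[of 2 "R / t"] assms by (auto simp: field_simps intro: less_imp_le)
  have k1: "R / 2 ^ k \<le> t" unfolding k_def using ex by (rule LeastI_ex)
  then have "k \<noteq> 0" using assms by (cases k) auto
  then obtain j where j: "k = Suc j" using not0_implies_Suc by blast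
  have "\<not> R / 2 ^ j \<le> t" using not_less_Least[of j "\<lambda>k. R / 2 ^ k \<le> t"] j k_def by auto
  then show ?thesis using k1 j by (intro exI[of _ j]) auto
qed

lemma power_bracket_above:
  fixes t r :: real
  assumes "0 < r" "r \<le> t"
  shows "\<exists>k::nat. r * 2 ^ k \<le> t \<and> t < r * 2 ^ Suc k"
proof -
  define k where "k = (LEAST k::nat. t < r * 2 ^ k)"
  have ex: "\<exists>k::nat. t < r * 2 ^ k"
    using real_arch_pow[of 2 "t / r"] assms by (auto simp: field_simps)
  have k1: "t < r * 2 ^ k" unfolding k_def using ex by (rule LeastI_ex)
  then have "k \<noteq> 0" using assms by (cases k) auto
  then obtain j where j: "k = Suc j" using not0_implies_Suc by blast
  have "\<not> t < r * 2 ^ j" using not_less_Least[of j "\<lambda>k. t < r * 2 ^ k"] j k_def by auto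
  then show ?thesis using k1 j by (intro exI[of _ j]) auto
qed

lemma power_powr_commute:
  fixes x e :: real
  assumes "0 < x"
  shows "(x ^ k) powr e = (x powr e) ^ k"
  using assms by (induction k) (auto simp: powr_mult)

text \<open>With radii halving from \<open>R\<close>, the annulus of outer radius
  \<open>\<rho> k\<close> contributes at most a fixed multiple of
  \<open>\<rho> k powr (2 - 2 * s)\<close>, a geometric series because \<open>s < 1\<close>. The
  power of \<open>R\<close> is kept explicit, with \<open>J\<close> independent of \<open>R\<close>,
  since the bound from above lets the test ball shrink near the boundary.\<close>

lemma integral_singular_kernel_near:
  fixes s :: real
  assumes "0 < s" "s < 1"
  defines "p \<equiv> real DIM('a) + 2 * s"
  shows "\<exists>J>0. \<forall>R>0. integrable lebesgue (\<lambda>y::'a::euclidean_space. indicator (ball 0 R) y * ((norm y)\<^sup>2 / norm y powr p))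
     \<and> (LINT y::'a|lebesgue. indicator (ball 0 R) y * ((norm y)\<^sup>2 / norm y powr p)) \<le> J * R powr (2 - 2 * s)"
proof -
  let ?n = "DIM('a)" let ?V = "unit_ball_vol (DIM('a))"
  define g where "g = (1/2::real) powr (2 - 2 * s)"
  have g: "0 < g" "g < 1" using assms by (auto simp: g_def intro: powr_less_mono2[of _ "1/2" 1, simplified])
  define J where "J = ?V * (2 powr p * (1 / (1 - g)))"
  have Jpos: "0 < J" using g by (simp add: J_def)
  have p0: "0 < p" using assms by (simp add: p_def add_nonneg_pos)
  have "integrable lebesgue (\<lambda>y::'a. indicator (ball 0 R) y * ((norm y)\<^sup>2 / norm y powr p))
     \<and> (LINT y::'a|lebesgue. indicator (ball 0 R) y * ((norm y)\<^sup>2 / norm y powr p)) \<le> J * R powr (2 - 2 * s)"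
    if R: "0 < R" for R :: real
  proof -
    define \<rho> where "\<rho> k = R / 2 ^ k" for k :: nat
    define a where "a k = (\<rho> k)\<^sup>2 / (\<rho> k / 2) powr p" for k
    have \<rho>: "0 < \<rho> k" for k using R by (simp add: \<rho>_def)
    have summand: "a k * \<rho> k ^ ?n = (2 powr p * R powr (2 - 2 * s)) * g ^ k" for k
    proof -
      have "a k * \<rho> k ^ ?n = 2 powr p * (\<rho> k powr 2 * \<rho> k powr real ?n / \<rho> k powr p)"
        using \<rho>[of k] by (simp add: a_def powr_divide powr_realpow)
      also have "\<rho> k powr 2 * \<rho> k powr real ?n / \<rho> k powr p = \<rho> k powr (2 - 2 * s)"
        by (simp add: powr_add[symmetric] powr_diff[symmetric] p_def)
      also have "\<dots> = R powr (2 - 2 * s) * (1 / 2 ^ k) powr (2 - 2 * s)"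
        using R by (simp add: \<rho>_def powr_mult[symmetric])
      also have "(1 / 2 ^ k) powr (2 - 2 * s) = g ^ k"
        using power_powr_commute[of "1/2" k] by (simp add: g_def power_one_over)
      finally show ?thesis by simp
    qed
    have sums: "(\<lambda>k. a k * \<rho> k ^ ?n) sums (2 powr p * R powr (2 - 2 * s) * (1 / (1 - g)))"
      unfolding summand using g by (intro sums_mult geometric_sums) auto
    let ?f = "\<lambda>y::'a. indicator (ball 0 R) y * ((norm y)\<^sup>2 / norm y powr p)"
    have ind: "(\<lambda>y::'a. indicator (ball 0 R) y :: real) \<in> borel_measurable lebesgue"
      by (intro borel_measurable_indicator) simp
    have "(\<lambda>y::'a. (norm y)\<^sup>2 / norm y powr p) \<in> borel_measurable lebesgue"
      by (rule borel_measurable_lebesgueI) measurable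
    with ind have meas: "?f \<in> borel_measurable lebesgue"
      by (rule borel_measurable_times)
    have cover: "\<exists>k. norm y < \<rho> k \<and> ?f y \<le> a k" if "0 < ?f y" for y
    proof -
      \<comment> \<open>The integrand is 0 at the origin, so positivity excludes the one point of
        the ball that lies in no dyadic annulus.\<close>
      have y: "y \<noteq> 0" "norm y < R" using that by (cases "norm y < R", auto)+
      then obtain k where k: "R / 2 ^ Suc k \<le> norm y" "norm y < R / 2 ^ k"
        using power_bracket_below[of "norm y" R] by auto
      have "(norm y)\<^sup>2 / norm y powr p \<le> (\<rho> k)\<^sup>2 / (\<rho> k / 2) powr p"
        using k y p0 \<rho>[of k] by (intro frac_le power_mono powr_mono2) (auto simp: \<rho>_def)
      then show ?thesis using k y by (intro exI[of _ k]) (auto simp: \<rho>_def a_def)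
    qed
    have a0: "0 \<le> a k" for k by (simp add: a_def)
    note main = integral_le_sum_over_balls[of ?f a \<rho>, OF meas _ a0 less_imp_le[OF \<rho>] sums cover]
    have eq: "?V * (2 powr p * R powr (2 - 2 * s) * (1 / (1 - g))) = J * R powr (2 - 2 * s)"
      by (simp add: J_def)
    show ?thesis using main unfolding eq by auto
  qed
  then show ?thesis using Jpos by blast
qed

text \<open>The counterpart at infinity: radii double from \<open>r\<close>, and each annulus
  contributes a multiple of \<open>\<rho> k powr (- 2 * s)\<close>, a geometric series because
  \<open>0 < s\<close>.\<close>

lemma integrable_kernel_away:
  fixes s r :: real
  assumes "0 < s" "0 < r"
  defines "p \<equiv> real DIM('a) + 2 * s"
  shows "integrable lebesgue (\<lambda>y::'a::euclidean_space. indicator (- ball 0 r) y * (1 / norm y powr p))"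
proof -
  let ?n = "DIM('a)"
  define g where "g = (1/2::real) powr (2 * s)"
  have g: "0 < g" "g < 1" using assms by (auto simp: g_def intro: powr_less_mono2[of _ "1/2" 1, simplified])
  have p0: "0 < p" using assms by (simp add: p_def add_nonneg_pos)
  define \<rho> where "\<rho> k = r * 2 ^ Suc k" for k :: nat
  define a where "a k = 1 / (\<rho> k / 2) powr p" for k
  have \<rho>: "0 < \<rho> k" for k using assms by (simp add: \<rho>_def)
  have summand: "a k * \<rho> k ^ ?n = (2 powr p * (2 * r) powr (- 2 * s)) * g ^ k" for k
  proof -
    have "a k * \<rho> k ^ ?n = 2 powr p * (\<rho> k powr real ?n / \<rho> k powr p)"
      using \<rho>[of k] by (simp add: a_def powr_divide powr_realpow)
    also have "\<rho> k powr real ?n / \<rho> k powr p = \<rho> k powr (- 2 * s)"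
      by (simp add: powr_diff[symmetric] p_def)
    also have "\<dots> = (2 * r) powr (- 2 * s) * (2 ^ k) powr (- 2 * s)"
      using assms by (simp add: \<rho>_def powr_mult[symmetric] ac_simps)
    also have "(2 ^ k) powr (- 2 * s) = (2 powr (- 2 * s)) ^ k"
      by (rule power_powr_commute) simp
    also have "2 powr (- 2 * s) = g"
      by (simp add: g_def powr_divide powr_minus_divide)
    finally show ?thesis by simp
  qed
  have sums: "(\<lambda>k. a k * \<rho> k ^ ?n) sums (2 powr p * (2 * r) powr (- 2 * s) * (1 / (1 - g)))"
    unfolding summand using g by (intro sums_mult geometric_sums) auto
  let ?f = "\<lambda>y::'a. indicator (- ball 0 r) y * (1 / norm y powr p)"
  have meas: "?f \<in> borel_measurable lebesgue"
    by (intro borel_measurable_lebesgueI) measurable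
  have cover: "\<exists>k. norm y < \<rho> k \<and> ?f y \<le> a k" if "0 < ?f y" for y
  proof -
    have y: "r \<le> norm y" using that by (cases "norm y < r") auto
    then obtain k where k: "r * 2 ^ k \<le> norm y" "norm y < r * 2 ^ Suc k"
      using power_bracket_above[of r "norm y"] assms by auto
    have "1 / norm y powr p \<le> 1 / (\<rho> k / 2) powr p"
      using k y p0 \<rho>[of k] by (intro frac_le powr_mono2) (auto simp: \<rho>_def)
    then show ?thesis using k y by (intro exI[of _ k]) (auto simp: \<rho>_def a_def)
  qed
  have a0: "0 \<le> a k" for k by (simp add: a_def)
  show ?thesis
    by (rule integral_le_sum_over_balls(1)[of ?f a \<rho>, OF meas _ a0 less_imp_le[OF \<rho>] sums cover]) auto
qed

subsection \<open>Testing with paraboloids\<close>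

text \<open>The bracket that multiplies the kernel in \<open>Lop\<close>. Linear terms cancel in it,
  so a paraboloid of opening \<open>A\<close> enters only through
  \<open>A * (norm y)\<^sup>2\<close>.\<close>

definition sdiff :: "('a::euclidean_space \<Rightarrow> real) \<Rightarrow> 'a \<Rightarrow> 'a \<Rightarrow> real" where
  "sdiff u x y = (u (x + y) + u (x - y)) / 2 - u x"

section \<open>The kernel around a point of the unit ball against the weight around the
  origin\<close>

text \<open>With \<open>m = max (norm y) r\<close>, both \<open>norm x\<close> and
  \<open>norm y\<close> are at most \<open>m / r\<close>, so \<open>norm (x + y)\<close> and 1 are
  at most \<open>2 / r * m\<close>. Moving the pole from \<open>x\<close> to the origin lets the
  weighted mass of \<open>u\<close> control what an operator sees at \<open>x\<close>.\<close>

lemma kernel_le_weight: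
  fixes x y :: "'a::real_normed_vector"
  assumes "0 < p" "norm x \<le> 1" "0 < r" "r \<le> 1"
  shows "1 / (max (norm y) r) powr p \<le> 2 * (2 / r) powr p * (1 / (1 + norm (x + y) powr p))"
proof -
  define m where "m = max (norm y) r"
  have m: "r \<le> m" "norm y \<le> m" "0 < m" using assms by (auto simp: m_def)
  have "m \<le> m / r" "1 \<le> m / r" using assms m by (auto simp: field_simps mult_left_le)
  moreover have "2 / r * m = m / r + m / r" by simp
  ultimately have b: "norm (x + y) \<le> 2 / r * m" "1 \<le> 2 / r * m"
    using norm_triangle_ineq[of x y] assms(2) m by auto
  have "1 + norm (x + y) powr p \<le> (2 / r * m) powr p + (2 / r * m) powr p"
    using b assms by (intro add_mono powr_mono2 ge_one_powr_ge_zero) auto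
  also have "\<dots> = 2 * (2 / r) powr p * m powr p"
    using assms m by (simp add: powr_mult powr_divide)
  finally have "1 + norm (x + y) powr p \<le> 2 * (2 / r) powr p * m powr p" .
  moreover have "0 < 1 + norm (x + y) powr p" by (simp add: add_pos_nonneg)
  ultimately show ?thesis using m by (simp add: m_def[symmetric] field_simps)
qed

lemma kernel_le_weight_away:
  fixes x y :: "'a::real_normed_vector"
  assumes "0 < p" "norm x \<le> 1" "0 < r" "r \<le> 1" "r \<le> norm y"
  shows "1 / norm y powr p \<le> 2 * (2 / r) powr p * (1 / (1 + norm (x + y) powr p))"
    and "1 / norm y powr p \<le> 2 * (2 / r) powr p * (1 / (1 + norm (x - y) powr p))"
  using kernel_le_weight[OF assms(1-4), of y] kernel_le_weight[OF assms(1-4), of "-y"] assms(5)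
  by (simp_all add: max_absorb1)

text \<open>Away from its pole the kernel is dominated by the translated weight, so weighted
  integrability of \<open>u\<close> suffices for the tails of every operator at
  \<open>x\<close>.\<close>

lemma integrable_away_translate:
  fixes u :: "'a::euclidean_space \<Rightarrow> real"
  assumes "0 < p" "norm x \<le> 1" "0 < r" "r \<le> 1"
    and u: "u \<in> borel_measurable lebesgue"
    and iu: "integrable lebesgue (\<lambda>x. u x / (1 + norm x powr p))"
  shows "integrable lebesgue (\<lambda>y. indicator (- ball 0 r) y * (\<bar>u (x + y)\<bar> / norm y powr p))"
    and "integrable lebesgue (\<lambda>y. indicator (- ball 0 r) y * (\<bar>u (x - y)\<bar> / norm y powr p))"
proof -
  let ?W = "\<lambda>z::'a. 1 / (1 + norm z powr p)"
  define c where "c = 2 * (2 / r) powr p"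
  have c0: "0 \<le> c" by (simp add: c_def)
  have m: "(\<lambda>x. u x / (1 + norm x powr p)) \<in> borel_measurable lebesgue" using iu by auto
  have W0: "0 < 1 + norm z powr p" for z :: 'a by (simp add: add_pos_nonneg)
  have n: "(\<lambda>y::'a. norm y powr p) \<in> borel_measurable lebesgue"
    by (rule borel_measurable_lebesgueI) measurable
  have ind: "(\<lambda>y::'a. indicator (- ball 0 r) y :: real) \<in> borel_measurable lebesgue"
    by (rule borel_measurable_lebesgueI) measurable
  have "integrable lebesgue (\<lambda>y. c * (u (x + y) / (1 + norm (x + y) powr p)))"
    using lebesgue_integral_translate(2)[OF m, of x] iu by (intro integrable_mult_right) simp
  moreover have "norm (indicator (- ball 0 r) y * (\<bar>u (x + y)\<bar> / norm y powr p))
      \<le> norm (c * (u (x + y) / (1 + norm (x + y) powr p)))" for y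
  proof (cases "r \<le> norm y")
    case True
    then have "\<bar>u (x + y)\<bar> * (1 / norm y powr p) \<le> \<bar>u (x + y)\<bar> * (c * ?W (x + y))"
      using kernel_le_weight_away(1)[OF assms(1-4) True] by (intro mult_left_mono) (auto simp: c_def)
    then show ?thesis using True c0 W0[of "x + y"] by (simp add: abs_mult mult_ac)
  qed auto
  ultimately show "integrable lebesgue (\<lambda>y. indicator (- ball 0 r) y * (\<bar>u (x + y)\<bar> / norm y powr p))"
    using n ind lebesgue_integral_translate(1)[OF u, of x]
    by (rule_tac Bochner_Integration.integrable_bound[where f = "\<lambda>y. c * (u (x + y) / (1 + norm (x + y) powr p))"]) auto
  have "integrable lebesgue (\<lambda>y. c * (u (x - y) / (1 + norm (x - y) powr p)))"
    using lebesgue_integral_reflect(2)[OF m, of x] iu by (intro integrable_mult_right) simp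
  moreover have "norm (indicator (- ball 0 r) y * (\<bar>u (x - y)\<bar> / norm y powr p))
      \<le> norm (c * (u (x - y) / (1 + norm (x - y) powr p)))" for y
  proof (cases "r \<le> norm y")
    case True
    then have "\<bar>u (x - y)\<bar> * (1 / norm y powr p) \<le> \<bar>u (x - y)\<bar> * (c * ?W (x - y))"
      using kernel_le_weight_away(2)[OF assms(1-4) True] by (intro mult_left_mono) (auto simp: c_def)
    then show ?thesis using True c0 W0[of "x - y"] by (simp add: abs_mult mult_ac)
  qed auto
  ultimately show "integrable lebesgue (\<lambda>y. indicator (- ball 0 r) y * (\<bar>u (x - y)\<bar> / norm y powr p))"
    using n ind lebesgue_integral_reflect(1)[OF u, of x]
    by (rule_tac Bochner_Integration.integrable_bound[where f = "\<lambda>y. c * (u (x - y) / (1 + norm (x - y) powr p))"]) auto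
qed

lemma C2_on_paraboloid:
  fixes x b :: "'a::euclidean_space"
  shows "C2_on UNIV (\<lambda>z. c + b \<bullet> (z - x) + A * (norm (z - x))\<^sup>2)"
proof -
  define D where "D z = blinfun_inner_left (b + (2 * A) *\<^sub>R (z - x))" for z :: 'a
  define D2 where "D2 = Blinfun (\<lambda>h::'a. blinfun_inner_left ((2 * A) *\<^sub>R h))"
  have bl: "bounded_linear (\<lambda>h::'a. blinfun_inner_left ((2 * A) *\<^sub>R h))"
    by (intro bounded_linear_compose[OF bounded_linear_blinfun_inner_left] bounded_linear_scaleR_right)
  have D2: "blinfun_apply D2 = (\<lambda>h. blinfun_inner_left ((2 * A) *\<^sub>R h))"
    unfolding D2_def by (rule bounded_linear_Blinfun_apply[OF bl])
  have 1: "((\<lambda>z. c + b \<bullet> (z - x) + A * (norm (z - x))\<^sup>2) has_derivative blinfun_apply (D z)) (at z)" for z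
    unfolding power2_norm_eq_inner D_def
    by (auto intro!: derivative_eq_intros simp: inner_commute algebra_simps fun_eq_iff)
  have 2: "(D has_derivative blinfun_apply D2) (at z)" for z
  proof -
    have eq: "D = (\<lambda>z. blinfun_inner_left (b - (2 * A) *\<^sub>R x) + blinfun_inner_left ((2 * A) *\<^sub>R z))"
      by (rule ext, rule blinfun_eqI) (simp add: D_def blinfun.add_left algebra_simps)
    show ?thesis unfolding eq D2
      using bounded_linear_imp_has_derivative[OF bl] by (auto intro!: derivative_eq_intros)
  qed
  show ?thesis unfolding C2_on_def using 1 2 by (intro exI[of _ D] exI[of _ "\<lambda>_. D2"]) auto
qed

text \<open>The test function is the paraboloid on \<open>ball x r\<close> and \<open>u\<close>
  elsewhere. Since \<open>x + y\<close> and \<open>x - y\<close> lie in the ball together or not at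
  all, its second difference is exactly \<open>A * (norm y)\<^sup>2\<close> for
  \<open>norm y < r\<close> and that of \<open>u\<close> otherwise. One integrable \<open>G\<close>
  thus dominates the integrands of all admissible kernels at once, and with them the
  supremum.\<close>

lemma visc_sub_paraboloid_test:
  fixes u G :: "'a::euclidean_space \<Rightarrow> real"
  assumes s: "0 < s" "s < 1" and lam: "0 < lam" "lam \<le> Lam"
  defines "p \<equiv> real DIM('a) + 2 * s"
  assumes visc: "visc_sub_Mplus lam Lam s D u f"
    and r: "0 < r" "r \<le> 1" "ball x r \<subseteq> D" and x: "norm x \<le> 1" and A: "0 \<le> A"
    and touch: "\<And>y. y \<in> ball x r \<Longrightarrow> y \<noteq> x \<Longrightarrow> u y < u x + b \<bullet> (y - x) + A * (norm (y - x))\<^sup>2"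
    and u: "u \<in> borel_measurable lebesgue"
    and iu: "integrable lebesgue (\<lambda>x. u x / (1 + norm x powr p))"
    and G: "integrable lebesgue G"
    and near: "\<And>y. y \<noteq> 0 \<Longrightarrow> norm y < r \<Longrightarrow> Lam * A * ((norm y)\<^sup>2 / norm y powr p) \<le> G y"
    and far: "\<And>y k. r \<le> norm y \<Longrightarrow> lam \<le> k \<Longrightarrow> k \<le> Lam \<Longrightarrow> k * sdiff u x y / norm y powr p \<le> G y"
  shows "f x \<le> (LINT y|lebesgue. G y)"
proof -
  have p0: "0 < p" using s by (simp add: p_def add_nonneg_pos)
  define \<phi> where "\<phi> z = u x + b \<bullet> (z - x) + A * (norm (z - x))\<^sup>2" for z
  define w where "w = (\<lambda>y. if y \<in> ball x r then \<phi> y else u y)"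
  have \<phi>m: "\<phi> \<in> borel_measurable lebesgue"
    unfolding \<phi>_def by (rule borel_measurable_lebesgueI) measurable
  have wm: "w \<in> borel_measurable lebesgue"
    unfolding w_def using \<phi>m u by (intro measurable_If_set) auto
  have "Lop K w x \<le> (LINT y|lebesgue. G y)" if K: "K \<in> kernels lam Lam s" for K
  proof -
    have Km: "K \<in> borel_measurable lebesgue" using K by (simp add: kernels_def)
    define h where "h y = sdiff w x y * K y" for y
    have hm: "h \<in> borel_measurable lebesgue"
      unfolding h_def sdiff_def
      using lebesgue_integral_translate(1)[OF wm, of x] lebesgue_integral_reflect(1)[OF wm, of x] Km by auto
    \<comment> \<open>The coefficient \<open>k\<close> varies with \<open>y\<close>, which is why
      \<open>far\<close> is assumed for every \<open>k\<close> between \<open>lam\<close> and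
      \<open>Lam\<close>. Kernel bounds are imposed only off the origin, a null set that the
      comparisons leave out.\<close>
    have Kb: "\<exists>k. lam \<le> k \<and> k \<le> Lam \<and> K y = k / norm y powr p" if "y \<noteq> 0" for y
    proof -
      have "lam / norm y powr p \<le> K y" "K y \<le> Lam / norm y powr p"
        using K that by (auto simp: kernels_def p_def)
      then show ?thesis using that
        by (intro exI[of _ "K y * norm y powr p"]) (auto simp: field_simps)
    qed
    have wnear: "sdiff w x y = A * (norm y)\<^sup>2" if "norm y < r" for y
      using that r by (simp add: sdiff_def w_def \<phi>_def dist_norm field_simps)
    have wfar: "sdiff w x y = sdiff u x y" if "r \<le> norm y" for y
      using that r by (simp add: sdiff_def w_def \<phi>_def dist_norm)
    have hG: "h y \<le> G y" if y: "y \<noteq> 0" for y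
    proof -
      obtain k where k: "lam \<le> k" "k \<le> Lam" "K y = k / norm y powr p" using Kb[OF y] by blast
      show ?thesis
      proof (cases "norm y < r")
        case True
        have "h y = k * (A * ((norm y)\<^sup>2 / norm y powr p))" by (simp add: h_def wnear[OF True] k)
        also have "\<dots> \<le> Lam * (A * ((norm y)\<^sup>2 / norm y powr p))"
          using k A by (intro mult_right_mono) auto
        finally show ?thesis using near[OF y True] by (simp add: mult.assoc)
      next
        case False
        then show ?thesis using far[of y k] k by (simp add: h_def wfar mult.commute)
      qed
    qed
    let ?near = "\<lambda>y::'a. indicator (ball 0 r) y * ((norm y)\<^sup>2 / norm y powr p)"
    let ?ker = "\<lambda>y::'a. indicator (- ball 0 r) y * (1 / norm y powr p)"
    let ?p = "\<lambda>y::'a. indicator (- ball 0 r) y * (\<bar>u (x + y)\<bar> / norm y powr p)"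
    let ?m = "\<lambda>y::'a. indicator (- ball 0 r) y * (\<bar>u (x - y)\<bar> / norm y powr p)"
    \<comment> \<open>An integrable majorant of the absolute value of \<open>h\<close>. It is what
      makes the pointwise comparison with \<open>G\<close> pass to integrals: a non-integrable
      function would have integral 0 by convention.\<close>
    let ?B = "\<lambda>y. Lam * A * ?near y + Lam * (?p y + ?m y + \<bar>u x\<bar> * ?ker y)"
    have "integrable lebesgue ?near"
      using integral_singular_kernel_near[OF s, where 'a = 'a] r unfolding p_def by blast
    moreover have "integrable lebesgue ?ker"
      using integrable_kernel_away[OF s(1) r(1), where 'a = 'a] unfolding p_def by blast
    ultimately have B: "integrable lebesgue ?B"
      using integrable_away_translate[OF p0 x r(1,2) u iu]
      by (intro Bochner_Integration.integrable_add integrable_mult_right) auto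
    have hB: "norm (h y) \<le> norm (?B y)" if y: "y \<noteq> 0" for y
    proof -
      obtain k where k: "lam \<le> k" "k \<le> Lam" "K y = k / norm y powr p" using Kb[OF y] by blast
      have "norm (h y) = k * (\<bar>sdiff w x y\<bar> / norm y powr p)"
        using k lam by (simp add: h_def abs_mult)
      also have "\<dots> \<le> Lam * (\<bar>sdiff w x y\<bar> / norm y powr p)"
        using k by (intro mult_right_mono) auto
      also have "\<dots> \<le> ?B y"
      proof (cases "norm y < r")
        case True
        then show ?thesis using A by (simp add: wnear)
      next
        case False
        have "\<bar>sdiff u x y\<bar> \<le> \<bar>u (x + y)\<bar> + \<bar>u (x - y)\<bar> + \<bar>u x\<bar>"
          unfolding sdiff_def by argo
        then have "\<bar>sdiff u x y\<bar> / norm y powr p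
            \<le> (\<bar>u (x + y)\<bar> + \<bar>u (x - y)\<bar> + \<bar>u x\<bar>) / norm y powr p"
          by (intro divide_right_mono) auto
        then have "Lam * (\<bar>sdiff u x y\<bar> / norm y powr p)
            \<le> Lam * ((\<bar>u (x + y)\<bar> + \<bar>u (x - y)\<bar> + \<bar>u x\<bar>) / norm y powr p)"
          using lam by (intro mult_left_mono) auto
        then show ?thesis using False
          by (simp add: wfar add_divide_distrib)
      qed
      finally show ?thesis by simp
    qed
    have ae: "AE y in lebesgue. y \<noteq> (0::'a)"
      by (rule AE_I'[of "{0}"]) auto
    have "integrable lebesgue h"
      using ae hB by (intro Bochner_Integration.integrable_bound[OF B hm]) auto
    then have "(LINT y|lebesgue. h y) \<le> (LINT y|lebesgue. G y)"
      using ae hG by (intro integral_mono_AE G) auto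
    then show ?thesis by (simp add: Lop_def h_def sdiff_def)
  qed
  then have "Mplus lam Lam s w x \<le> ereal (LINT y|lebesgue. G y)"
    unfolding Mplus_def by (intro SUP_least) auto
  moreover have "ereal (f x) \<le> Mplus lam Lam s w x"
  proof -
    have "x \<in> D \<and> open (ball x r) \<and> x \<in> ball x r \<and> ball x r \<subseteq> D \<and> open UNIV \<and> closure (ball x r) \<subseteq> UNIV \<and>
        C2_on UNIV \<phi> \<and> \<phi> x = u x \<and> (\<forall>y\<in>ball x r - {x}. \<phi> y > u y)"
      using r touch C2_on_paraboloid[of "u x" b x A] unfolding \<phi>_def by (auto simp: subset_iff)
    then show ?thesis using visc unfolding visc_sub_Mplus_def w_def by blast
  qed
  ultimately show ?thesis using order_trans by fastforce
qed

subsection \<open>Local boundedness of subsolutions\<close>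

lemma sdiff_le_of_paraboloid:
  assumes "u (x + h) \<le> u x + b \<bullet> h + A * (norm h)\<^sup>2" "u (x - h) \<le> u x - b \<bullet> h + A * (norm h)\<^sup>2"
  shows "sdiff u x h \<le> A * (norm h)\<^sup>2"
  using add_mono[OF assms] by (simp add: sdiff_def field_simps)

lemma continuous_on_open_ball_inside:
  fixes u :: "'a::metric_space \<Rightarrow> real"
  assumes "open D" "continuous_on D u" "x \<in> D" "open V" "u x \<in> V"
  obtains r where "0 < r" "r \<le> 1" "ball x r \<subseteq> D" "\<And>y. y \<in> ball x r \<Longrightarrow> u y \<in> V"
proof -
  have "open (D \<inter> u -` V)" by (rule continuous_open_preimage[OF assms(2,1,4)])
  then obtain e where e: "0 < e" "ball x e \<subseteq> D \<inter> u -` V"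
    using assms by (auto elim: openE)
  have "ball x (min e 1) \<subseteq> ball x e" by auto
  then show ?thesis using e that[of "min e 1"] by (auto simp: subset_iff)
qed

text \<open>How ellipticity is exploited throughout: if the second difference \<open>t\<close> is below a bound \<open>w\<close> coming
  from a touching paraboloid, the excess \<open>w - t\<close> can still be charged at the rate \<open>lam\<close>.\<close>
lemma mult_between_le:
  fixes k t w lam Lam :: real
  assumes "lam \<le> k" "k \<le> Lam" "0 \<le> w" "t \<le> w"
  shows "k * t \<le> Lam * w - lam * (w - t)"
proof -
  have "k * w \<le> Lam * w" "lam * (w - t) \<le> k * (w - t)"
    using assms by (auto intro: mult_right_mono)
  then show ?thesis by (simp add: algebra_simps)
qed

text \<open>\<open>kernel_le_weight\<close> averaged over \<open>y\<close> and \<open>-y\<close>. If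
  \<open>u\<close> has unit weighted mass, the right-hand side integrates to
  \<open>2 * (2 / r) powr p\<close>; this is how neighbouring values of \<open>u\<close> enter the
  majorants.\<close>

lemma weighted_mean_le:
  fixes u :: "'a::real_normed_vector \<Rightarrow> real"
  assumes "0 < p" "norm x \<le> 1" "0 < r" "r \<le> 1" "\<And>z. 0 \<le> u z"
  shows "1 / (max (norm y) r) powr p * ((u (x + y) + u (x - y)) / 2)
    \<le> 2 * (2 / r) powr p * ((u (x + y) / (1 + norm (x + y) powr p) + u (x - y) / (1 + norm (x - y) powr p)) / 2)"
proof -
  have "1 / (max (norm y) r) powr p * u (x + y) \<le> 2 * (2 / r) powr p * (1 / (1 + norm (x + y) powr p)) * u (x + y)"
    by (intro mult_right_mono kernel_le_weight assms)
  moreover have "1 / (max (norm y) r) powr p * u (x - y) \<le> 2 * (2 / r) powr p * (1 / (1 + norm (x - y) powr p)) * u (x - y)"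
    using kernel_le_weight[OF assms(1-4), of "-y"] assms(5) by (intro mult_right_mono) auto
  moreover have "k * ((a + b) / 2) \<le> c * ((a / v + b / w) / 2)"
    if "k * a \<le> c * (1 / v) * a" "k * b \<le> c * (1 / w) * b" for k a b c v w :: real
  proof -
    have "k * ((a + b) / 2) = (k * a + k * b) / 2" by (simp add: algebra_simps)
    also have "\<dots> \<le> (c * (1 / v) * a + c * (1 / w) * b) / 2"
      using that by (intro divide_right_mono add_mono) auto
    also have "\<dots> = c * ((a / v + b / w) / 2)" by (simp add: add_divide_distrib distrib_left)
    finally show ?thesis .
  qed
  ultimately show ?thesis by blast
qed

text \<open>The radius of the viscosity test depends on how fast \<open>u\<close> varies near
  \<open>x\<close>; here it is traded for a prescribed radius \<open>R\<close>. The three terms are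
  the cost of the paraboloid, the gain from subtracting \<open>u x\<close> at a rate of at least
  \<open>lam / R powr p\<close> on the whole ball, and the contribution of neighbouring values,
  bounded through the unit mass.\<close>

lemma subsolution_test_on_ball:
  fixes u :: "'a::euclidean_space \<Rightarrow> real"
  assumes s: "0 < s" "s < 1" and lam: "0 < lam" "lam \<le> Lam"
  defines "p \<equiv> real DIM('a) + 2 * s"
  assumes J: "\<And>R. 0 < R \<Longrightarrow> (LINT y::'a|lebesgue. indicator (ball 0 R) y * ((norm y)\<^sup>2 / norm y powr p)) \<le> J * R powr (2 - 2 * s)"
    and visc: "visc_sub_Mplus lam Lam s D u f" and D: "open D" "continuous_on D u" "x \<in> D"
    and R: "0 < R" "R \<le> 1" and x: "norm x \<le> 1" and A: "0 < A" and upos: "0 < u x" "\<And>z. 0 \<le> u z"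
    and touch: "\<And>h. norm h < R \<Longrightarrow> u (x + h) \<le> u x + b \<bullet> h + A * (norm h)\<^sup>2"
    and u: "u \<in> borel_measurable lebesgue"
    and iu: "integrable lebesgue (\<lambda>x. u x / (1 + norm x powr p))"
      "(LINT x|lebesgue. u x / (1 + norm x powr p)) = 1"
  shows "f x \<le> 2 * Lam * A * (J * R powr (2 - 2 * s))
     - lam * (1 / R powr p) * (u x / 2) * (unit_ball_vol (DIM('a)) * R ^ DIM('a))
     + 4 * Lam * (2 / R) powr p"
proof -
  have p0: "0 < p" using s by (simp add: p_def add_nonneg_pos)
  \<comment> \<open>Inside the test ball \<open>u\<close> is replaced by the paraboloid and the gain
    \<open>e\<close> is not visible. There \<open>u\<close> exceeds \<open>u x / 2\<close>, so the
    mass term of \<open>G\<close> is large enough to pay for subtracting \<open>e\<close> all the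
    same.\<close>
  obtain r0 where r0: "0 < r0" "r0 \<le> 1" "ball x r0 \<subseteq> D" "\<And>y. y \<in> ball x r0 \<Longrightarrow> u y \<in> {u x / 2<..}"
    using continuous_on_open_ball_inside[OF D, of "{u x / 2<..}"] upos by auto
  define r where "r = min r0 R"
  have r: "0 < r" "r \<le> 1" "r \<le> R" "ball x r \<subseteq> D" using r0 R by (auto simp: r_def subset_iff)
  have rlow: "u x / 2 < u (x + y)" "u x / 2 < u (x - y)" if "norm y < r" for y
    using r0(4)[of "x + y"] r0(4)[of "x - y"] that by (auto simp: r_def dist_norm)
  let ?avg = "\<lambda>y. (u (x + y) + u (x - y)) / 2"
  let ?uW = "\<lambda>x. u x / (1 + norm x powr p)"
  define g where "g y = (?uW (x + y) + ?uW (x - y)) / 2" for y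
  define c where "c = 2 * (2 / R) powr p"
  \<comment> \<open>Only half of \<open>u x\<close> is charged, because half is what the average is
    known to exceed inside the test ball.\<close>
  define e where "e = lam * (1 / R powr p) * (u x / 2)"
  have wm: "1 / (max (norm y) R) powr p * ?avg y \<le> c * g y" for y
    using weighted_mean_le[OF p0 x R, of u y] upos by (simp add: c_def g_def)
  have g: "integrable lebesgue g" "(LINT y|lebesgue. g y) = 1"
    using integral_symmetric_mean[OF iu(1), of x] iu(2) unfolding g_def by auto
  have cg0: "0 \<le> c * g y" for y
    using upos by (auto simp: c_def g_def add_nonneg_nonneg)
  have sd: "sdiff u x h \<le> A * (norm h)\<^sup>2" if "norm h < R" for h
    using touch[of h] touch[of "-h"] that by (intro sdiff_le_of_paraboloid[of _ _ _ b]) auto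
  let ?near = "\<lambda>y::'a. indicator (ball 0 R) y * ((norm y)\<^sup>2 / norm y powr p)"
  define \<nu> where "\<nu> = ?near"
  define \<iota> where "\<iota> y = (indicator (ball 0 R) y :: real)" for y :: 'a
  \<comment> \<open>The paraboloid opening is doubled because the test lemma needs strict touching.\<close>
  define G where "G y = 2 * Lam * A * \<nu> y - e * \<iota> y + 2 * Lam * (c * g y)" for y :: 'a
  have G: "G y = 2 * Lam * A * ?near y - e * indicator (ball 0 R) y + 2 * Lam * (c * g y)" for y
    by (simp add: G_def \<nu>_def \<iota>_def)
  have inear: "integrable lebesgue \<nu>"
    using integral_singular_kernel_near[OF s, where 'a = 'a] R unfolding p_def \<nu>_def by blast
  note ib = integral_indicator_ball[OF less_imp_le[OF R(1)], of "0::'a"]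
  have ichi: "integrable lebesgue \<iota>" unfolding \<iota>_def by (rule ib(1))
  have iG: "integrable lebesgue G" unfolding G_def
    by (intro Bochner_Integration.integrable_add Bochner_Integration.integrable_diff integrable_mult_right inear ichi g)
  have "f x \<le> (LINT y|lebesgue. G y)"
  proof (rule visc_sub_paraboloid_test[OF s lam visc r(1,2,4) x, where A = "2 * A" and b = b, folded p_def])
    show "0 \<le> 2 * A" using A by simp
    show "u y < u x + b \<bullet> (y - x) + 2 * A * (norm (y - x))\<^sup>2" if "y \<in> ball x r" "y \<noteq> x" for y
    proof -
      have "u y \<le> u x + b \<bullet> (y - x) + A * (norm (y - x))\<^sup>2"
        using touch[of "y - x"] that r by (simp add: dist_norm norm_minus_commute)
      moreover have "0 < A * (norm (y - x))\<^sup>2" using that A by simp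
      ultimately show ?thesis by simp
    qed
    show "Lam * (2 * A) * ((norm y)\<^sup>2 / norm y powr p) \<le> G y" if "y \<noteq> 0" "norm y < r" for y
    proof -
      have "u x / 2 \<le> ?avg y" using rlow[OF that(2)] by argo
      then have "1 / R powr p * (u x / 2) \<le> 1 / R powr p * ?avg y"
        by (intro mult_left_mono) auto
      also have "\<dots> \<le> c * g y" using wm[of y] that r by (simp add: max_absorb2)
      finally have "lam * (1 / R powr p * (u x / 2)) \<le> lam * (c * g y)"
        using lam by (intro mult_left_mono) auto
      also have "\<dots> \<le> 2 * Lam * (c * g y)" using lam cg0[of y] by (intro mult_right_mono) auto
      finally have "e \<le> 2 * Lam * (c * g y)" unfolding e_def by (simp only: mult.assoc)
      then show ?thesis using that r by (simp add: G mult_ac)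
    qed
    show "k * sdiff u x y / norm y powr p \<le> G y" if y: "r \<le> norm y" and k: "lam \<le> k" "k \<le> Lam" for y k
    proof (cases "norm y < R")
      case True
      let ?w = "A * (norm y)\<^sup>2"
      have y0: "0 < norm y" using y r by linarith
      have "k * sdiff u x y / norm y powr p \<le> (Lam * ?w - lam * (?w - sdiff u x y)) / norm y powr p"
        using A sd[OF True] by (intro divide_right_mono mult_between_le k) auto
      also have "\<dots> = Lam * A * ?near y - lam * ((?w - sdiff u x y) / norm y powr p)"
        using True by (simp add: diff_divide_distrib right_diff_distrib)
      also have "(?w - sdiff u x y) / R powr p \<le> (?w - sdiff u x y) / norm y powr p"
        using sd[OF True] y0 True p0 R by (intro divide_left_mono powr_mono2 mult_pos_pos) auto
      then have "Lam * A * ?near y - lam * ((?w - sdiff u x y) / norm y powr p)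
          \<le> Lam * A * ?near y - lam * ((?w - sdiff u x y) / R powr p)"
        using lam by (intro diff_left_mono mult_left_mono) auto
      also have "\<dots> \<le> 2 * Lam * A * ?near y - lam * ((u x - ?avg y) / R powr p)"
      proof (rule diff_mono)
        show "Lam * A * ?near y \<le> 2 * Lam * A * ?near y"
          using lam A by (intro mult_right_mono) auto
        show "lam * ((u x - ?avg y) / R powr p) \<le> lam * ((?w - sdiff u x y) / R powr p)"
          using lam A by (intro mult_left_mono divide_right_mono) (auto simp: sdiff_def)
      qed
      also have "\<dots> \<le> 2 * Lam * A * ?near y - lam * (u x / R powr p) + lam * (c * g y)"
      proof -
        have "lam * (1 / R powr p * ?avg y) \<le> lam * (c * g y)"
          using wm[of y] True lam by (intro mult_left_mono) (auto simp: max_absorb2)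
        then show ?thesis by (simp add: diff_divide_distrib right_diff_distrib)
      qed
      also have "\<dots> \<le> G y"
      proof -
        have arith: "N - d + a \<le> G'" if "a \<le> b" "e = d / 2" "0 \<le> d" "G' = N - e + b" for N d a b G' :: real
          using that by linarith
        show ?thesis
        proof (rule arith)
          show "lam * (c * g y) \<le> 2 * Lam * (c * g y)" using lam cg0[of y] by (intro mult_right_mono) auto
          show "e = lam * (u x / R powr p) / 2" by (simp add: e_def)
          show "0 \<le> lam * (u x / R powr p)" using lam upos by simp
          show "G y = 2 * Lam * A * ?near y - e + 2 * Lam * (c * g y)"
            using True by (simp add: G)
        qed
      qed
      finally show ?thesis .
    next
      case False
      then have yR: "R \<le> norm y" by simp
      have "k * sdiff u x y / norm y powr p \<le> k * (?avg y / norm y powr p)"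
      proof -
        have "sdiff u x y = ?avg y - u x" by (simp add: sdiff_def)
        then have "sdiff u x y \<le> ?avg y" using upos(1) by linarith
        then have "k * (sdiff u x y / norm y powr p) \<le> k * (?avg y / norm y powr p)"
          using k lam by (intro mult_left_mono divide_right_mono) auto
        then show ?thesis by simp
      qed
      also have "\<dots> \<le> k * (c * g y)"
        using wm[of y] yR k lam by (intro mult_left_mono) (auto simp: max_absorb1)
      also have "\<dots> \<le> 2 * Lam * (c * g y)" using k lam cg0[of y] by (intro mult_right_mono) auto
      finally show ?thesis using yR by (simp add: G)
    qed
  qed (use u iu iG in auto)
  also have "(LINT y|lebesgue. G y) = 2 * Lam * A * (LINT y|lebesgue. \<nu> y)
      - e * (LINT y|lebesgue. \<iota> y) + 2 * Lam * (c * (LINT y|lebesgue. g y))"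
    unfolding G_def using inear ichi g(1) by simp
  also have "\<dots> \<le> 2 * Lam * A * (J * R powr (2 - 2 * s))
      - e * (unit_ball_vol (DIM('a)) * R ^ DIM('a)) + 2 * Lam * (c * 1)"
  proof -
    have "2 * Lam * A * (LINT y|lebesgue. \<nu> y) \<le> 2 * Lam * A * (J * R powr (2 - 2 * s))"
      unfolding \<nu>_def using J[OF R(1)] lam A by (intro mult_left_mono) auto
    then show ?thesis unfolding \<iota>_def ib(2) g(2) by simp
  qed
  finally show ?thesis by (simp add: e_def c_def)
qed

section \<open>A barrier that blows up at a sphere, and the bound from above\<close>

text \<open>The induction multiplies by
  \<open>1 / (1 - \<tau>) \<le> 1 + \<tau> + 2 * \<tau>\<^sup>2\<close> and absorbs cubic and
  quartic terms using \<open>\<bar>\<tau>\<bar> \<le> 1/2\<close>. The linear coefficient is exact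
  because the main part of that term cancels in second differences.\<close>

lemma inverse_power_taylor:
  "\<exists>B\<ge>0. \<forall>\<tau>::real. \<bar>\<tau>\<bar> \<le> 1/2 \<longrightarrow> (1 / (1 - \<tau>)) ^ n \<le> 1 + real n * \<tau> + B * \<tau>\<^sup>2"
proof (induction n)
  case 0
  show ?case by (intro exI[of _ 0]) auto
next
  case (Suc n)
  then obtain B where B: "0 \<le> B" "\<And>\<tau>::real. \<bar>\<tau>\<bar> \<le> 1/2 \<Longrightarrow> (1 / (1 - \<tau>)) ^ n \<le> 1 + real n * \<tau> + B * \<tau>\<^sup>2"
    by auto
  have "(1 / (1 - \<tau>)) ^ Suc n \<le> 1 + real (Suc n) * \<tau> + (2 * B + 2 * real n + 2) * \<tau>\<^sup>2"
    if t: "\<bar>\<tau>\<bar> \<le> 1/2" for \<tau> :: real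
  proof -
    have 1: "1 / (1 - \<tau>) \<le> 1 + \<tau> + 2 * \<tau>\<^sup>2"
    proof -
      have "0 \<le> \<tau>\<^sup>2 * (1 - 2 * \<tau>)" using t by simp
      then have "1 \<le> (1 + \<tau> + 2 * \<tau>\<^sup>2) * (1 - \<tau>)"
        by (simp add: algebra_simps power2_eq_square power3_eq_cube)
      then show ?thesis using t by (simp add: pos_divide_le_eq abs_le_iff)
    qed
    have "(1 / (1 - \<tau>)) ^ Suc n \<le> (1 + \<tau> + 2 * \<tau>\<^sup>2) * (1 + real n * \<tau> + B * \<tau>\<^sup>2)"
      unfolding power_Suc using t 1 B(2)[OF t] by (intro mult_mono) (auto intro: order_trans[OF _ 1])
    also have "\<dots> = 1 + real (Suc n) * \<tau> + (B + real n + 2) * \<tau>\<^sup>2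
        + (B + 2 * real n) * (\<tau> * \<tau>\<^sup>2) + 2 * B * (\<tau>\<^sup>2 * \<tau>\<^sup>2)"
      by (simp add: algebra_simps power2_eq_square)
    also have "\<dots> \<le> 1 + real (Suc n) * \<tau> + (B + real n + 2) * \<tau>\<^sup>2
        + (B + 2 * real n) * (1/2 * \<tau>\<^sup>2) + 2 * B * (1/4 * \<tau>\<^sup>2)"
    proof -
      have "\<tau>\<^sup>2 \<le> (1/2)\<^sup>2" using t by (metis abs_ge_zero power2_abs power_mono)
      then have "\<tau>\<^sup>2 * \<tau>\<^sup>2 \<le> 1/4 * \<tau>\<^sup>2" by (intro mult_right_mono) (auto simp: power2_eq_square)
      moreover have "\<tau> * \<tau>\<^sup>2 \<le> 1/2 * \<tau>\<^sup>2" using t by (intro mult_right_mono) auto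
      ultimately show ?thesis using B(1) by (intro add_mono mult_left_mono) auto
    qed
    also have "\<dots> = 1 + real (Suc n) * \<tau> + (2 * B + 2 * real n + 2) * \<tau>\<^sup>2"
      by (simp add: field_simps)
    finally show ?thesis .
  qed
  then show ?case using B(1) by (intro exI[of _ "2 * B + 2 * real n + 2"]) auto
qed

text \<open>The shifted denominator is \<open>q * (1 - \<tau>)\<close> with
  \<open>\<tau> = (2 * (x \<bullet> h) + (norm h)\<^sup>2) / q\<close>, and
  \<open>norm h \<le> q / 8\<close> gives
  \<open>\<bar>\<tau>\<bar> \<le> 3 * norm h / q \<le> 1/2\<close>. The expansion in \<tau> then
  becomes a paraboloid whose opening grows like the inverse square of \<open>q\<close>.\<close>

lemma barrier_paraboloid_bound:
  fixes x h :: "'a::real_inner"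
  assumes B: "0 \<le> B" "\<And>\<tau>::real. \<bar>\<tau>\<bar> \<le> 1/2 \<Longrightarrow> (1 / (1 - \<tau>)) ^ n \<le> 1 + real n * \<tau> + B * \<tau>\<^sup>2"
    and q: "q = R\<^sup>2 - (norm x)\<^sup>2" "0 < q" "q \<le> 1" and x: "norm x \<le> 1" and h: "norm h \<le> q / 8"
  shows "0 < R\<^sup>2 - (norm (x + h))\<^sup>2"
    and "(q / (R\<^sup>2 - (norm (x + h))\<^sup>2)) ^ n \<le> 1 + (2 * real n / q) * (x \<bullet> h) + (real n + 9 * B) / q\<^sup>2 * (norm h)\<^sup>2"
proof -
  define \<tau> where "\<tau> = (2 * (x \<bullet> h) + (norm h)\<^sup>2) / q"
  have xh: "\<bar>x \<bullet> h\<bar> \<le> norm h"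
    using Cauchy_Schwarz_ineq2[of x h] x mult_right_mono[OF x, of "norm h"] by simp
  have "norm h \<le> 1" using h q by simp
  then have hh: "(norm h)\<^sup>2 \<le> norm h" by (simp add: power2_eq_square mult_left_le)
  have t3: "\<bar>2 * (x \<bullet> h) + (norm h)\<^sup>2\<bar> \<le> 3 * norm h"
    using xh hh zero_le_power2[of "norm h"] by linarith
  have ta: "\<bar>\<tau>\<bar> \<le> 3 * norm h / q"
    using t3 q unfolding \<tau>_def abs_divide by (simp add: divide_right_mono)
  also have "\<dots> \<le> 3 * (q / 8) / q" using h q by (intro divide_right_mono) auto
  also have "\<dots> \<le> 1/2" using q by simp
  finally have t: "\<bar>\<tau>\<bar> \<le> 1/2" .
  have "q * \<tau> = 2 * (x \<bullet> h) + (norm h)\<^sup>2" using q by (simp add: \<tau>_def)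
  then have eq: "R\<^sup>2 - (norm (x + h))\<^sup>2 = q * (1 - \<tau>)"
    unfolding right_diff_distrib q(1) by (simp add: power2_norm_eq_inner inner_commute algebra_simps)
  show "0 < R\<^sup>2 - (norm (x + h))\<^sup>2" unfolding eq using q t by (simp add: abs_le_iff)
  have "q / (R\<^sup>2 - (norm (x + h))\<^sup>2) = 1 / (1 - \<tau>)" unfolding eq using q by simp
  then have "(q / (R\<^sup>2 - (norm (x + h))\<^sup>2)) ^ n \<le> 1 + real n * \<tau> + B * \<tau>\<^sup>2"
    using B(2)[OF t] by simp
  also have "\<dots> \<le> 1 + ((2 * real n / q) * (x \<bullet> h) + real n / q\<^sup>2 * (norm h)\<^sup>2) + B * ((3 * norm h / q)\<^sup>2)"
  proof (intro add_mono mult_left_mono order_refl B(1))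
    have "q\<^sup>2 \<le> q" using q by (simp add: power2_eq_square mult_left_le)
    then have "real n / q * (norm h)\<^sup>2 \<le> real n / q\<^sup>2 * (norm h)\<^sup>2"
      using q by (intro mult_right_mono divide_left_mono) auto
    then show "real n * \<tau> \<le> (2 * real n / q) * (x \<bullet> h) + real n / q\<^sup>2 * (norm h)\<^sup>2"
      by (simp add: \<tau>_def add_divide_distrib distrib_left mult_ac)
    show "\<tau>\<^sup>2 \<le> (3 * norm h / q)\<^sup>2" using ta by (metis abs_ge_zero power2_abs power_mono)
  qed
  also have "\<dots> = 1 + (2 * real n / q) * (x \<bullet> h) + (real n + 9 * B) / q\<^sup>2 * (norm h)\<^sup>2"
    by (simp add: power_divide power_mult_distrib add_divide_distrib algebra_simps)
  finally show "(q / (R\<^sup>2 - (norm (x + h))\<^sup>2)) ^ n \<le> 1 + (2 * real n / q) * (x \<bullet> h) + (real n + 9 * B) / q\<^sup>2 * (norm h)\<^sup>2" .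
qed

text \<open>Here \<open>q\<close> measures the distance to the sphere of radius 7/8. In a test ball
  of radius proportional to \<open>q\<close>, unit mass permits values of the order of its inverse
  volume; hence the dimension is the right exponent for the weight
  \<open>q x ^ DIM('a)\<close>.\<close>

lemma subsolution_upper_bound:
  fixes s lam Lam :: real
  assumes s: "0 < s" "s < 1" and lam: "0 < lam" "lam \<le> Lam"
  defines "p \<equiv> real DIM('a) + 2 * s"
  shows "\<exists>C>0. \<forall>\<Omega> (u :: 'a::euclidean_space \<Rightarrow> real) \<delta>.
     open \<Omega> \<and> continuous_on (ball 0 1) u \<and> \<delta> \<le> 1 \<and>
     visc_sub_Mplus lam Lam s (ball 0 1 \<inter> \<Omega>) u (\<lambda>x. - \<delta>) \<and>
     (\<forall>x\<in>ball 0 1 - \<Omega>. u x = 0) \<and> (\<forall>x. 0 \<le> u x) \<and> u \<in> borel_measurable lebesgue \<and>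
     integrable lebesgue (\<lambda>x. u x / (1 + norm x powr p)) \<and>
     (LINT x|lebesgue. u x / (1 + norm x powr p)) = 1
     \<longrightarrow> (\<forall>x\<in>cball 0 (3/4). u x \<le> C)"
proof -
  let ?n = "DIM('a)"
  define V where "V = unit_ball_vol ?n"
  have V: "0 < V" by (simp add: V_def)
  obtain J where J: "0 < J" "\<And>R. 0 < R \<Longrightarrow> (LINT y::'a|lebesgue. indicator (ball 0 R) y * ((norm y)\<^sup>2 / norm y powr p)) \<le> J * R powr (2 - 2 * s)"
    using integral_singular_kernel_near[OF s, where 'a = 'a] unfolding p_def by blast
  obtain B where B: "0 \<le> B" "\<And>\<tau>::real. \<bar>\<tau>\<bar> \<le> 1/2 \<Longrightarrow> (1 / (1 - \<tau>)) ^ ?n \<le> 1 + real ?n * \<tau> + B * \<tau>\<^sup>2"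
    using inverse_power_taylor[of ?n] by auto
  define B' where "B' = real ?n + 9 * B"
  have B': "0 < B'" using B(1) by (simp add: B'_def add_pos_nonneg)
  \<comment> \<open>Testing on a ball of radius \<open>\<theta> * q m\<close> makes the barrier contribute at most half of the gain
    that comes from the unit mass of \<open>u\<close> being too small to fill the ball.\<close>
  define \<theta> where "\<theta> = min (1/8) (sqrt (lam * V / (8 * Lam * J * B')))"
  have L: "0 < Lam" using lam by simp
  have \<theta>: "0 < \<theta>" "\<theta> \<le> 1/8" using lam V J B' L by (auto simp: \<theta>_def)
  have "\<theta>\<^sup>2 \<le> (sqrt (lam * V / (8 * Lam * J * B')))\<^sup>2" using \<theta> by (intro power_mono) (auto simp: \<theta>_def)
  also have "\<dots> = lam * V / (8 * Lam * J * B')" using lam V J B' L by simp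
  finally have \<theta>2: "2 * Lam * J * B' * \<theta>\<^sup>2 \<le> lam * V / 4"
    using L J B' by (simp add: field_simps)
  \<comment> \<open>What survives multiplication by \<open>q m ^ DIM('a)\<close>: at most 1 from
    \<delta>, and the mass term, whose denominator \<open>R ^ DIM('a)\<close> with
    \<open>R = \<theta> * q m\<close> cancels the power of \<open>q m\<close>.\<close>
  define M where "M = 1 + 4 * Lam * 2 powr p / \<theta> ^ ?n"
  have M: "0 < M" using L \<theta> by (simp add: M_def add_pos_pos)
  define T0 where "T0 = 4 * M / (lam * V)"
  \<comment> \<open>The factor comes from \<open>(7/8)\<^sup>2 - (3/4)\<^sup>2 = 13/64\<close>, a
    lower bound for \<open>q\<close> on \<open>cball 0 (3/4)\<close>.\<close>
  define C where "C = T0 * (64/13) ^ ?n"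
  have T0: "0 < T0" using M lam V by (simp add: T0_def)
  then have C: "0 < C" by (simp add: C_def)
  have "\<forall>x\<in>cball 0 (3/4). u x \<le> C" if
     \<Omega>: "open \<Omega>" and uc: "continuous_on (ball 0 1) u" and \<delta>: "\<delta> \<le> 1"
     and visc: "visc_sub_Mplus lam Lam s (ball 0 1 \<inter> \<Omega>) u (\<lambda>x. - \<delta>)"
     and u0: "\<And>x. x \<in> ball 0 1 - \<Omega> \<Longrightarrow> u x = 0" and upos: "\<And>x. 0 \<le> u x" and um: "u \<in> borel_measurable lebesgue"
     and iu: "integrable lebesgue (\<lambda>x. u x / (1 + norm x powr p))" "(LINT x|lebesgue. u x / (1 + norm x powr p)) = 1"
     for \<Omega> and u :: "'a \<Rightarrow> real" and \<delta>
  proof -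
    \<comment> \<open>As 7/8 lies between 3/4 and 1, \<open>u\<close> is continuous on the closed
      ball while \<open>q\<close> stays away from 0 on \<open>cball 0 (3/4)\<close>. As
      \<open>q\<close> vanishes on the sphere of radius 7/8, a positive maximum is attained
      inside.\<close>
    define q where "q x = (7/8)\<^sup>2 - (norm x)\<^sup>2" for x :: 'a
    have qpos: "0 \<le> q x" if "x \<in> cball 0 (7/8)" for x
      using that by (simp add: q_def)
    have q1: "q x \<le> 1" for x
    proof -
      have "(7/8::real)\<^sup>2 \<le> 1" by (simp add: power2_eq_square)
      then show ?thesis using zero_le_power2[of "norm x"] unfolding q_def by linarith
    qed
    have "continuous_on (cball 0 (7/8)) (\<lambda>x. u x * q x ^ ?n)"
      unfolding q_def by (intro continuous_intros continuous_on_subset[OF uc]) auto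
    then obtain m where m: "m \<in> cball 0 (7/8)" "\<And>y. y \<in> cball 0 (7/8) \<Longrightarrow> u y * q y ^ ?n \<le> u m * q m ^ ?n"
      using continuous_attains_sup[of "cball (0::'a) (7/8)" "\<lambda>x. u x * q x ^ ?n"] by auto
    have bound: "u m * q m ^ ?n \<le> T0"
    proof (cases "u m * q m ^ ?n \<le> 0")
      case True
      then show ?thesis using T0 by simp
    next
      case False
      then have um0: "0 < u m" "0 < q m"
        using upos[of m] qpos[OF m(1)] by (auto simp: less_le zero_power)
      have mb: "norm m \<le> 7/8" using m(1) by simp
      \<comment> \<open>\<open>u\<close> vanishes on the unit ball outside \<Omega>, so its positive
        value places \<open>m\<close> in \<Omega>, where the viscosity inequality is
        available.\<close>
      have mD: "m \<in> ball 0 1 \<inter> \<Omega>" using mb um0 u0[of m] by auto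
      define R where "R = \<theta> * q m"
      have qR: "R \<le> q m / 8" using \<theta> um0 by (simp add: R_def)
      then have "R \<le> 1" using q1[of m] by linarith
      then have R: "0 < R" "R \<le> 1" using \<theta> um0 by (auto simp: R_def)
      define A where "A = B' * u m / (q m)\<^sup>2"
      have A: "0 < A" using B' um0 by (simp add: A_def)
      \<comment> \<open>\<open>u\<close> lies below the barrier \<open>u m * (q m / q y) ^ n\<close>, which blows up at the boundary of the ball.\<close>
      have touch: "u (m + h) \<le> u m + ((u m * 2 * real ?n / q m) *\<^sub>R m) \<bullet> h + A * (norm h)\<^sup>2" if h: "norm h < R" for h
      proof -
        have h': "norm h \<le> q m / 8" using h qR by simp
        have "norm m \<le> 1" using mb by simp
        note bp = barrier_paraboloid_bound[OF B q_def um0(2) q1 this h', folded q_def]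
        have "(norm (m + h))\<^sup>2 < (7/8)\<^sup>2" using bp(1) by (simp add: q_def)
        then have "norm (m + h) < 7/8" by (rule power_less_imp_less_base) simp
        then have "u (m + h) * q (m + h) ^ ?n \<le> u m * q m ^ ?n" by (intro m(2)) simp
        then have "u (m + h) \<le> u m * (q m / q (m + h)) ^ ?n"
          using bp(1) by (simp add: power_divide pos_le_divide_eq)
        also have "\<dots> \<le> u m * (1 + (2 * real ?n / q m) * (m \<bullet> h) + (real ?n + 9 * B) / (q m)\<^sup>2 * (norm h)\<^sup>2)"
          using um0 by (intro mult_left_mono bp(2)) auto
        also have "\<dots> = u m + ((u m * 2 * real ?n / q m) *\<^sub>R m) \<bullet> h + A * (norm h)\<^sup>2"
          by (simp add: A_def B'_def algebra_simps)
        finally show ?thesis .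
      qed
      have cont: "continuous_on (ball 0 1 \<inter> \<Omega>) u" by (rule continuous_on_subset[OF uc]) auto
      have D: "open (ball 0 1 \<inter> \<Omega>)" using \<Omega> by auto
      have m1: "norm m \<le> 1" using mb by simp
      have "- \<delta> \<le> 2 * Lam * A * (J * R powr (2 - 2 * s))
         - lam * (1 / R powr p) * (u m / 2) * (unit_ball_vol ?n * R ^ ?n) + 4 * Lam * (2 / R) powr p"
        using subsolution_test_on_ball[OF s lam J(2)[unfolded p_def] visc D cont mD R m1 A um0(1) upos touch um
            iu[unfolded p_def]] unfolding p_def .
      \<comment> \<open>Multiplication by \<open>R powr (2 * s)\<close> cancels the fractional
        powers on the right: the barrier term becomes a small multiple of \<open>u m\<close>, the
        gain a fixed multiple of \<open>u m\<close>, and the mass term a multiple of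
        \<open>1 / R ^ DIM('a)\<close>.\<close>
      then have "- \<delta> * R powr (2 * s) \<le> (2 * Lam * A * (J * R powr (2 - 2 * s))
         - lam * (1 / R powr p) * (u m / 2) * (V * R ^ ?n) + 4 * Lam * (2 / R) powr p) * R powr (2 * s)"
        unfolding V_def by (intro mult_right_mono) auto
      also have "\<dots> = 2 * Lam * A * J * (R powr (2 - 2 * s) * R powr (2 * s))
         - lam * (u m / 2) * V * (R ^ ?n * R powr (2 * s) / R powr p)
         + 4 * Lam * 2 powr p * (R powr (2 * s) / R powr p)"
        using R by (simp add: algebra_simps powr_divide)
      also have "R powr (2 - 2 * s) * R powr (2 * s) = R\<^sup>2"
        using R by (simp add: powr_add[symmetric])
      also have "R ^ ?n * R powr (2 * s) / R powr p = 1"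
        using R by (simp add: powr_realpow[symmetric] powr_add[symmetric] p_def)
      also have "R powr (2 * s) / R powr p = 1 / R ^ ?n"
        using R by (simp add: powr_realpow[symmetric] powr_diff[symmetric] p_def powr_minus_divide)
      also have "2 * Lam * A * J * R\<^sup>2 = (2 * Lam * J * B' * \<theta>\<^sup>2) * u m"
        using um0 by (simp add: A_def R_def power_mult_distrib)
      also have "\<dots> - lam * (u m / 2) * V * 1 + 4 * Lam * 2 powr p * (1 / R ^ ?n)
          \<le> lam * V / 4 * u m - lam * (u m / 2) * V * 1 + 4 * Lam * 2 powr p * (1 / R ^ ?n)"
        using mult_right_mono[OF \<theta>2 less_imp_le[OF um0(1)]] by (intro add_mono diff_mono) simp_all
      also have "\<dots> = 4 * Lam * 2 powr p * (1 / R ^ ?n) - lam * V / 4 * u m"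
        by (simp add: algebra_simps)
      finally have 1: "lam * V / 4 * u m \<le> \<delta> * R powr (2 * s) + 4 * Lam * 2 powr p * (1 / R ^ ?n)"
        by simp
      have "R powr (2 * s) \<le> 1" using R s by (intro powr_le1) auto
      then have "\<delta> * R powr (2 * s) \<le> 1" using \<delta> mult_right_mono[OF \<delta>, of "R powr (2 * s)"] by simp
      with 1 have "lam * V / 4 * u m \<le> 1 + 4 * Lam * 2 powr p * (1 / R ^ ?n)" by linarith
      then have "lam * V / 4 * u m * q m ^ ?n \<le> (1 + 4 * Lam * 2 powr p * (1 / R ^ ?n)) * q m ^ ?n"
        using um0 by (intro mult_right_mono) auto
      also have "\<dots> = q m ^ ?n + 4 * Lam * 2 powr p / \<theta> ^ ?n"
        using um0 \<theta> by (simp add: R_def power_mult_distrib field_simps)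
      also have "\<dots> \<le> M" using um0 q1[of m] by (simp add: M_def power_le_one)
      finally show ?thesis using lam V by (simp add: T0_def field_simps)
    qed
    show ?thesis
    proof
      fix x :: 'a assume x: "x \<in> cball 0 (3/4)"
      have "(norm x)\<^sup>2 \<le> (3/4)\<^sup>2" using x by (intro power_mono) auto
      then have q: "13/64 \<le> q x" by (simp add: q_def power2_eq_square)
      have "u x * (13/64) ^ ?n \<le> u x * q x ^ ?n"
        using q upos by (intro mult_left_mono power_mono) auto
      also have "\<dots> \<le> u m * q m ^ ?n" using x by (intro m(2)) auto
      also have "\<dots> \<le> T0" by (rule bound)
      finally have "u x * (13/64) ^ ?n * (64/13) ^ ?n \<le> T0 * (64/13) ^ ?n" by (intro mult_right_mono) auto
      moreover have "u x * (13/64) ^ ?n * (64/13) ^ ?n = u x"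
        by (simp add: mult.assoc power_mult_distrib[symmetric])
      ultimately show "u x \<le> C" unfolding C_def by linarith
    qed
  qed
  then show ?thesis using C by (intro exI[of _ C]) blast
qed

subsection \<open>Positivity of supersolutions\<close>

text \<open>Either \<open>norm b \<le> 1\<close> and \<open>norm a \<le> 2\<close>, or
  \<open>norm a \<le> 2 * norm b\<close>. This recentres the weight at a contact point of the unit
  ball and so bounds from below the mass seen from there.\<close>

lemma weight_translate_le:
  fixes a b :: "'a::real_normed_vector"
  assumes "0 < p" "norm (a - b) \<le> 1"
  shows "1 / (1 + norm b powr p) \<le> (1 + 2 powr p) * (1 / (1 + norm a powr p))"
proof -
  have n: "norm a \<le> 1 + norm b" using assms(2) norm_triangle_ineq2[of a b] by linarith
  have "norm a powr p \<le> 2 powr p * (1 + norm b powr p)"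
  proof (cases "norm b \<le> 1")
    case True
    then have "norm a powr p \<le> 2 powr p" using n assms(1) by (intro powr_mono2) auto
    also have "\<dots> \<le> 2 powr p * (1 + norm b powr p)" by simp
    finally show ?thesis .
  next
    case False
    then have "norm a powr p \<le> (2 * norm b) powr p" using n assms(1) by (intro powr_mono2) auto
    also have "\<dots> \<le> 2 powr p * (1 + norm b powr p)" by (simp add: powr_mult)
    finally show ?thesis .
  qed
  then have "1 + norm a powr p \<le> (1 + norm b powr p) + 2 powr p * (1 + norm b powr p)"
    by (intro add_mono) auto
  also have "\<dots> = (1 + 2 powr p) * (1 + norm b powr p)" by (simp only: distrib_right mult_1)
  finally have le: "1 + norm a powr p \<le> (1 + 2 powr p) * (1 + norm b powr p)" .
  have arith: "1 / y \<le> c * (1 / x)" if "x \<le> c * y" "0 < x" "0 < y" for x y c :: real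
    using that by (simp add: field_simps)
  show ?thesis by (rule arith[OF le]) (simp_all add: add_pos_nonneg)
qed

text \<open>The weight is at most 1 on the unit ball and at most the kernel outside it.\<close>

lemma integrable_weight:
  fixes s :: real
  assumes "0 < s"
  defines "p \<equiv> real DIM('a) + 2 * s"
  shows "integrable lebesgue (\<lambda>y::'a::euclidean_space. 1 / (1 + norm y powr p))"
proof -
  let ?B = "\<lambda>y::'a. indicator (ball 0 1) y + indicator (- ball 0 1) y * (1 / norm y powr p)"
  have iB: "integrable lebesgue ?B"
    using integral_indicator_ball(1)[of 1 "0::'a"] integrable_kernel_away[OF assms(1), of 1, where 'a = 'a]
    unfolding p_def by (intro Bochner_Integration.integrable_add) auto
  have m: "(\<lambda>y::'a. 1 / (1 + norm y powr p)) \<in> borel_measurable lebesgue"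
    by (rule borel_measurable_lebesgueI) measurable
  have le: "norm (1 / (1 + norm y powr p)) \<le> norm (?B y)" for y :: 'a
  proof (cases "norm y < 1")
    case True
    have "1 / (1 + norm y powr p) \<le> 1 / 1" by (rule frac_le) simp_all
    moreover have "?B y = 1 / 1" using True by simp
    moreover have "0 \<le> 1 / (1 + norm y powr p)" by simp
    ultimately show ?thesis by (simp only: real_norm_def abs_of_nonneg abs_one div_by_1)
  next
    case False
    then have "y \<noteq> 0" by auto
    then have "0 < norm y powr p" by simp
    then have "0 < (1 + norm y powr p) * norm y powr p"
      by (intro mult_pos_pos add_pos_nonneg) simp_all
    then have "1 / (1 + norm y powr p) \<le> 1 / norm y powr p" by (intro divide_left_mono) simp_all
    moreover have "?B y = 1 / norm y powr p" using False by simp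
    moreover have "0 \<le> 1 / (1 + norm y powr p)" "0 \<le> 1 / norm y powr p" by simp_all
    ultimately show ?thesis by (simp only: real_norm_def abs_of_nonneg)
  qed
  show ?thesis by (rule Bochner_Integration.integrable_bound[OF iB m]) (rule AE_I2, rule le)
qed

text \<open>If \<open>u\<close> is too small somewhere in \<open>cball x0 \<rho>\<close>, it falls
  below a paraboloid of height \<open>4 * \<rho>\<^sup>2 * t\<close> that vanishes on the sphere of
  radius \<open>2 * \<rho>\<close>, and the difference has a negative minimum at an interior point
  \<open>m\<close>. There all errors are of order \<open>t\<close>, while the unit mass contributes
  the fixed amount \<open>- lam * c0\<close>.\<close>

lemma supersolution_lower_bound:
  fixes s lam Lam \<rho> :: real
  assumes s: "0 < s" "s < 1" and lam: "0 < lam" "lam \<le> Lam" and \<rho>: "0 < \<rho>"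
  defines "p \<equiv> real DIM('a) + 2 * s"
  shows "\<exists>c>0. \<forall>\<Omega> (u :: 'a::euclidean_space \<Rightarrow> real) x0 \<delta>.
     open \<Omega> \<and> ball x0 (2 * \<rho>) \<subseteq> \<Omega> \<inter> ball 0 (1/2) \<and> continuous_on (ball 0 1) u \<and> \<delta> \<le> c \<and>
     visc_sub_Mplus lam Lam s (ball 0 1 \<inter> \<Omega>) (\<lambda>x. - u x) (\<lambda>x. - \<delta>) \<and>
     (\<forall>x. 0 \<le> u x) \<and> u \<in> borel_measurable lebesgue \<and>
     integrable lebesgue (\<lambda>x. u x / (1 + norm x powr p)) \<and>
     (LINT x|lebesgue. u x / (1 + norm x powr p)) = 1
     \<longrightarrow> (\<forall>x\<in>cball x0 \<rho>. c \<le> u x)"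
proof -
  have p0: "0 < p" using s by (simp add: p_def add_nonneg_pos)
  have L: "0 < Lam" using lam by simp
  let ?near = "\<lambda>y::'a. indicator (ball 0 (2 * \<rho>)) y * ((norm y)\<^sup>2 / norm y powr p)"
  let ?far = "\<lambda>y::'a. indicator (- ball 0 (2 * \<rho>)) y * (1 / norm y powr p)"
  let ?W = "\<lambda>y::'a. 1 / (1 + norm y powr p)"
  define \<nu> where "\<nu> = ?near"
  define \<phi> where "\<phi> = ?far"
  define W where "W = ?W"
  have inear: "integrable lebesgue \<nu>"
    using integral_singular_kernel_near[OF s, where 'a = 'a] \<rho> unfolding p_def \<nu>_def by fastforce
  have ifar: "integrable lebesgue \<phi>"
    using integrable_kernel_away[OF s(1), of "2 * \<rho>", where 'a = 'a] \<rho> unfolding p_def \<phi>_def by simp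
  have iW: "integrable lebesgue W"
    using integrable_weight[OF s(1), where 'a = 'a] unfolding p_def W_def .
  \<comment> \<open>\<open>N\<close> integrates against the kernel the profile
    \<open>(norm y)\<^sup>2\<close> inside radius \<open>2 * \<rho>\<close>, continued by the
    constant \<open>4 * \<rho>\<^sup>2\<close>. \<open>C1 * t\<close> will be the sum of all
    errors.\<close>
  define N where "N = (LINT y|lebesgue. \<nu> y) + 4 * \<rho>\<^sup>2 * (LINT y|lebesgue. \<phi> y)"
  define C1 where "C1 = 2 * Lam * N + lam * (4 * \<rho>\<^sup>2 + 1) * (LINT y|lebesgue. W y)"
  have "0 \<le> N" unfolding N_def \<nu>_def \<phi>_def by (intro add_nonneg_nonneg mult_nonneg_nonneg integral_nonneg_AE) auto
  moreover have "0 \<le> (LINT y|lebesgue. W y)" unfolding W_def by (intro integral_nonneg_AE) auto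
  ultimately have C1: "0 \<le> C1" using lam L unfolding C1_def by (intro add_nonneg_nonneg mult_nonneg_nonneg) auto
  define c0 where "c0 = 1 / (1 + 2 powr p)"
  have c0: "0 < c0" by (simp add: c0_def add_pos_nonneg)
  \<comment> \<open>The errors \<open>C1 * t\<close> then use up at most half of
    \<open>lam * c0\<close>; the added 1 keeps the denominator positive even for
    \<open>C1 = 0\<close>.\<close>
  define t where "t = lam * c0 / (2 * (C1 + 1))"
  have t: "0 < t" using lam c0 C1 by (simp add: t_def)
  have "C1 * t \<le> (C1 + 1) * t" using t by simp
  also have "\<dots> = lam * c0 / 2"
  proof -
    have "d * (a / (2 * d)) = a / 2" if "d \<noteq> 0" for a d :: real using that by simp
    from this[of "C1 + 1"] show ?thesis using C1 by (simp only: t_def)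
  qed
  finally have C1t: "C1 * t \<le> lam * c0 / 2" .
  \<comment> \<open>\<open>3 * \<rho>\<^sup>2 * t\<close> is the height of the paraboloid at
    distance \<rho> from \<open>x0\<close>. The other bound leaves at most three quarters of
    \<open>lam * c0\<close> for \<delta> and the errors together, which is the final
    contradiction.\<close>
  define c where "c = min (lam * c0 / 4) (3 * \<rho>\<^sup>2 * t)"
  have c: "0 < c" using lam c0 t \<rho> by (simp add: c_def)
  have "c \<le> u x" if
     \<Omega>: "open \<Omega>" and sub: "ball x0 (2 * \<rho>) \<subseteq> \<Omega> \<inter> ball 0 (1/2)" and uc: "continuous_on (ball 0 1) u" and \<delta>: "\<delta> \<le> c"
     and visc: "visc_sub_Mplus lam Lam s (ball 0 1 \<inter> \<Omega>) (\<lambda>x. - u x) (\<lambda>x. - \<delta>)"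
     and upos: "\<And>x. 0 \<le> u x" and um: "u \<in> borel_measurable lebesgue"
     and iu: "integrable lebesgue (\<lambda>x. u x / (1 + norm x powr p))" "(LINT x|lebesgue. u x / (1 + norm x powr p)) = 1"
     and x: "x \<in> cball x0 \<rho>"
     for \<Omega> and u :: "'a \<Rightarrow> real" and x0 \<delta> x
  proof (rule ccontr)
    assume "\<not> c \<le> u x"
    then have ux: "u x < 3 * \<rho>\<^sup>2 * t" by (auto simp: c_def)
    have cb: "cball x0 (2 * \<rho>) \<subseteq> cball 0 (1/2)"
      using closure_mono[of "ball x0 (2 * \<rho>)" "ball 0 (1/2)"] sub \<rho> by auto
    then have cb1: "cball x0 (2 * \<rho>) \<subseteq> ball 0 1" by (force simp: subset_iff)
    define w where "w y = u y - t * (4 * \<rho>\<^sup>2 - (norm (y - x0))\<^sup>2)" for y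
    have "continuous_on (cball x0 (2 * \<rho>)) w"
      unfolding w_def by (intro continuous_intros continuous_on_subset[OF uc cb1])
    then obtain m where m: "m \<in> cball x0 (2 * \<rho>)" "\<And>y. y \<in> cball x0 (2 * \<rho>) \<Longrightarrow> w m \<le> w y"
      using continuous_attains_inf[of "cball x0 (2 * \<rho>)" w] \<rho> by auto
    have "w x < 0"
    proof -
      have "(norm (x - x0))\<^sup>2 \<le> \<rho>\<^sup>2" using x by (intro power_mono) (auto simp: dist_norm norm_minus_commute)
      then have "t * (3 * \<rho>\<^sup>2) \<le> t * (4 * \<rho>\<^sup>2 - (norm (x - x0))\<^sup>2)" using t by (intro mult_left_mono) auto
      then show ?thesis using ux by (simp add: w_def mult_ac)
    qed
    moreover have "w m \<le> w x" using x \<rho> by (intro m(2)) auto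
    ultimately have wm: "w m < 0" by simp
    have wout: "0 \<le> w y" if "2 * \<rho> \<le> norm (y - x0)" for y
    proof -
      have "(2 * \<rho>)\<^sup>2 \<le> (norm (y - x0))\<^sup>2" using that \<rho> by (intro power_mono) auto
      then have "t * (4 * \<rho>\<^sup>2 - (norm (y - x0))\<^sup>2) \<le> 0" using t by (simp add: mult_nonneg_nonpos power_mult_distrib)
      then show ?thesis using upos[of y] by (simp add: w_def)
    qed
    have wmin: "w m \<le> w y" for y
    proof (cases "y \<in> cball x0 (2 * \<rho>)")
      case False
      then show ?thesis using wout[of y] wm by (simp add: dist_norm norm_minus_commute)
    qed (rule m(2))
    have "m \<in> ball x0 (2 * \<rho>)" using wout[of m] wm by (auto simp: dist_norm norm_minus_commute not_le[symmetric])
    then have mD: "m \<in> ball 0 1 \<inter> \<Omega>" using sub cb1 ball_subset_cball by blast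
    then have m1: "norm m \<le> 1" by simp
    have "t * (4 * \<rho>\<^sup>2 - (norm (m - x0))\<^sup>2) \<le> t * (4 * \<rho>\<^sup>2)" using t by simp
    then have "u m \<le> t * (4 * \<rho>\<^sup>2)" using wm unfolding w_def by linarith
    then have um4: "u m \<le> 4 * \<rho>\<^sup>2 * t" by (simp add: mult_ac)
    define b where "b = (2 * t) *\<^sub>R (m - x0)"
    have touch: "- u y \<le> - u m + b \<bullet> (y - m) + t * (norm (y - m))\<^sup>2" for y
    proof -
      have "t * ((norm (y - x0))\<^sup>2 - (norm (m - x0))\<^sup>2) = b \<bullet> (y - m) + t * (norm (y - m))\<^sup>2"
        unfolding b_def power2_norm_eq_inner by (simp add: algebra_simps inner_commute)
      moreover have "- u y \<le> - u m + t * ((norm (y - x0))\<^sup>2 - (norm (m - x0))\<^sup>2)"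
        using wmin[of y] by (simp add: w_def algebra_simps)
      ultimately show ?thesis by simp
    qed
    have D: "open (ball 0 1 \<inter> \<Omega>)" using \<Omega> by auto
    have cont: "continuous_on (ball 0 1 \<inter> \<Omega>) u" by (rule continuous_on_subset[OF uc]) auto
    \<comment> \<open>The test hides the mass of \<open>u\<close> inside its ball. By continuity the
      values there stay below \<open>(4 * \<rho>\<^sup>2 + 1) * t\<close>, so the hidden part is one
      more error of order \<open>t\<close>; this is the source of the summand 1 in
      \<open>4 * \<rho>\<^sup>2 + 1\<close>.\<close>
    obtain r0 where r0: "0 < r0" "r0 \<le> 1" "ball m r0 \<subseteq> ball 0 1 \<inter> \<Omega>" "\<And>y. y \<in> ball m r0 \<Longrightarrow> u y \<in> {..<u m + t}"
      using continuous_on_open_ball_inside[OF D cont mD, of "{..<u m + t}"] t by auto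
    define r where "r = min r0 (2 * \<rho>)"
    have r: "0 < r" "r \<le> 1" "ball m r \<subseteq> ball 0 1 \<inter> \<Omega>" "r \<le> 2 * \<rho>" using r0 \<rho> by (auto simp: r_def)
    have rup: "u (m + y) < u m + t" "u (m - y) < u m + t" if "norm y < r" for y
      using r0(4)[of "m + y"] r0(4)[of "m - y"] that by (auto simp: r_def dist_norm)
    let ?v = "\<lambda>x. - u x"
    let ?avg = "\<lambda>y. (u (m + y) + u (m - y)) / 2"
    let ?uW = "\<lambda>x. u x / (1 + norm x powr p)"
    define g where "g y = (?uW (m + y) + ?uW (m - y)) / 2" for y
    have g: "integrable lebesgue g" "(LINT y|lebesgue. g y) = 1"
      using integral_symmetric_mean[OF iu(1), of m] iu(2) unfolding g_def by auto
    have sd: "sdiff ?v m y = u m - ?avg y" for y by (simp add: sdiff_def field_simps)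
    \<comment> \<open>As \<open>norm m \<le> 1\<close>, both \<open>m + y\<close> and the reflected
      point \<open>- (m - y)\<close> lie within distance 1 of \<open>y\<close>, so their weights are
      comparable to that at \<open>y\<close>.\<close>
    have c0g: "c0 * g y \<le> ?W y * ?avg y" for y
    proof -
      have W: "c0 * (u z / (1 + norm z powr p)) \<le> ?W y * u z" if "norm (y - z) \<le> 1 \<or> norm (y + z) \<le> 1" for z
      proof -
        have "1 / (1 + norm z powr p) \<le> (1 + 2 powr p) * ?W y"
          using that weight_translate_le[OF p0, of y z] weight_translate_le[OF p0, of y "- z"] by auto
        then have "c0 * (1 / (1 + norm z powr p)) \<le> ?W y"
          using c0 by (simp add: c0_def divide_simps mult_ac add_pos_nonneg)
        then have "c0 * (1 / (1 + norm z powr p)) * u z \<le> ?W y * u z" using upos by (intro mult_right_mono) auto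
        then show ?thesis by simp
      qed
      have "c0 * ?uW (m + y) \<le> ?W y * u (m + y)" "c0 * ?uW (m - y) \<le> ?W y * u (m - y)"
        using W[of "m + y"] W[of "m - y"] m1 by simp_all
      then have "(c0 * ?uW (m + y) + c0 * ?uW (m - y)) / 2 \<le> (?W y * u (m + y) + ?W y * u (m - y)) / 2"
        by (intro divide_right_mono add_mono) auto
      then show ?thesis by (simp add: g_def add_divide_distrib distrib_left)
    qed
    define G where "G y = 2 * Lam * t * (\<nu> y + 4 * \<rho>\<^sup>2 * \<phi> y) + lam * (4 * \<rho>\<^sup>2 + 1) * t * W y - lam * (c0 * g y)" for y
    have G: "G y = 2 * Lam * t * (?near y + 4 * \<rho>\<^sup>2 * ?far y) + lam * (4 * \<rho>\<^sup>2 + 1) * t * ?W y - lam * (c0 * g y)" for y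
      by (simp add: G_def \<nu>_def \<phi>_def W_def)
    have iG: "integrable lebesgue G" unfolding G_def
      by (intro Bochner_Integration.integrable_add Bochner_Integration.integrable_diff integrable_mult_right inear ifar iW g)
    have "- \<delta> \<le> (LINT y|lebesgue. G y)"
    proof (rule visc_sub_paraboloid_test[OF s lam visc r(1,2,3) m1, where A = "2 * t" and b = b, folded p_def])
      show "0 \<le> 2 * t" using t by simp
      show "- u y < - u m + b \<bullet> (y - m) + 2 * t * (norm (y - m))\<^sup>2" if "y \<noteq> m" for y
      proof -
        have "0 < t * (norm (y - m))\<^sup>2" using that t by simp
        then show ?thesis using touch[of y] by simp
      qed
      show "Lam * (2 * t) * ((norm y)\<^sup>2 / norm y powr p) \<le> G y" if y: "y \<noteq> 0" "norm y < r" for y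
      proof -
        have "?avg y \<le> (4 * \<rho>\<^sup>2 + 1) * t" using rup[OF y(2)] um4 by (simp add: algebra_simps)
        then have "?W y * ?avg y \<le> ?W y * ((4 * \<rho>\<^sup>2 + 1) * t)" by (intro mult_left_mono) auto
        then have "lam * (c0 * g y) \<le> lam * (?W y * ((4 * \<rho>\<^sup>2 + 1) * t))"
          using c0g[of y] lam by (intro mult_left_mono) auto
        then show ?thesis using y r by (simp add: G mult_ac)
      qed
      show "k * sdiff ?v m y / norm y powr p \<le> G y" if y: "r \<le> norm y" and k: "lam \<le> k" "k \<le> Lam" for y k
      proof -
        have y0: "0 < norm y" using y r by linarith
        \<comment> \<open>The paraboloid lies above \<open>- u\<close> on the whole space, but
          \<open>(norm y)\<^sup>2\<close> times the kernel is not integrable at infinity. Beyond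
          radius \<open>2 * \<rho>\<close> it is replaced by the bound on \<open>u m\<close>, which
          works because \<open>u\<close> is nonnegative.\<close>
        define \<omega> where "\<omega> = t * (norm y powr p * (?near y + 4 * \<rho>\<^sup>2 * ?far y))"
        have \<omega>0: "0 \<le> \<omega>" using t by (simp add: \<omega>_def)
        have \<omega>: "sdiff ?v m y \<le> \<omega>"
        proof (cases "norm y < 2 * \<rho>")
          case True
          have "sdiff ?v m y \<le> t * (norm y)\<^sup>2"
            using touch[of "m + y"] touch[of "m - y"] by (intro sdiff_le_of_paraboloid[of _ _ _ b]) auto
          then show ?thesis using True y0 by (simp add: \<omega>_def)
        next
          case False
          have "sdiff ?v m y \<le> u m" unfolding sd using upos[of "m + y"] upos[of "m - y"] by simp
          also have "\<dots> \<le> \<omega>" using False y0 um4 by (simp add: \<omega>_def mult_ac)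
          finally show ?thesis .
        qed
        have "k * sdiff ?v m y / norm y powr p \<le> (Lam * \<omega> - lam * (\<omega> - sdiff ?v m y)) / norm y powr p"
          by (intro divide_right_mono mult_between_le k \<omega>0 \<omega>) auto
        also have "\<dots> = Lam * (\<omega> / norm y powr p) - lam * ((\<omega> - sdiff ?v m y) * (1 / norm y powr p))"
          by (simp add: diff_divide_distrib right_diff_distrib)
        also have "\<dots> \<le> Lam * (\<omega> / norm y powr p) - lam * ((\<omega> - sdiff ?v m y) * ?W y)"
          using \<omega> lam y0 by (intro diff_left_mono mult_left_mono frac_le) auto
        also have "\<dots> \<le> Lam * (\<omega> / norm y powr p) - lam * ((?avg y - 4 * \<rho>\<^sup>2 * t) * ?W y)"
          using \<omega>0 um4 lam unfolding sd by (intro diff_left_mono mult_left_mono mult_right_mono) auto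
        also have "\<dots> = Lam * (\<omega> / norm y powr p) + lam * (4 * \<rho>\<^sup>2) * t * ?W y - lam * (?W y * ?avg y)"
          by (simp add: left_diff_distrib right_diff_distrib mult_ac)
        also have "\<dots> \<le> G y"
        proof -
          have "Lam * (\<omega> / norm y powr p) = Lam * t * (?near y + 4 * \<rho>\<^sup>2 * ?far y)"
            using y0 by (simp add: \<omega>_def)
          also have "\<dots> \<le> 2 * Lam * t * (?near y + 4 * \<rho>\<^sup>2 * ?far y)"
            using L t by (intro mult_right_mono) auto
          finally have "Lam * (\<omega> / norm y powr p) \<le> 2 * Lam * t * (?near y + 4 * \<rho>\<^sup>2 * ?far y)" .
          moreover have "lam * (4 * \<rho>\<^sup>2) * t * ?W y \<le> lam * (4 * \<rho>\<^sup>2 + 1) * t * ?W y"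
            using lam t by (intro mult_right_mono mult_left_mono) auto
          moreover have "lam * (c0 * g y) \<le> lam * (?W y * ?avg y)"
            using c0g[of y] lam by (intro mult_left_mono) auto
          ultimately show ?thesis unfolding G by (intro diff_mono add_mono)
        qed
        finally show ?thesis .
      qed
    qed (use um iu iG in auto)
    also have "(LINT y|lebesgue. G y) = C1 * t - lam * c0"
      unfolding G_def C1_def N_def using inear ifar iW g by (simp add: algebra_simps)
    finally have "lam * c0 \<le> \<delta> + C1 * t" by simp
    moreover have "\<delta> \<le> lam * c0 / 4" using \<delta> by (simp add: c_def)
    moreover have "0 < lam * c0" using lam c0 by simp
    ultimately show False using C1t by linarith
  qed
  then show ?thesis using c by (intro exI[of _ c]) blast
qed

subsection \<open>Comparison of two solutions\<close>

text \<open>At the penalised maximum point all positive contributions are bounded by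
  \<open>I\<close>, which is free of \<open>C\<close> because \<open>v\<close> enters them only with
  a favourable sign. On the ball around \<open>x0\<close> the difference is at most
  \<open>C0 - C * c0 = - d\<close>, which contributes \<open>- \<kappa> * d * V\<close>. Hence
  \<open>d\<close>, and with it \<open>C\<close>, can be chosen after all other constants.\<close>

lemma quotient_upper_bound:
  fixes s lam Lam \<rho> C0 c0 :: real
  assumes s: "0 < s" "s < 1" and lam: "0 < lam" "lam \<le> Lam" and \<rho>: "0 < \<rho>" and C0: "0 < C0" and c0: "0 < c0"
  defines "p \<equiv> real DIM('a) + 2 * s"
  shows "\<exists>C>0. \<forall>\<Omega> (u :: 'a::euclidean_space \<Rightarrow> real) v x0.
     open \<Omega> \<and> ball x0 (2 * \<rho>) \<subseteq> \<Omega> \<inter> ball 0 (1/2) \<and>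
     continuous_on (ball 0 1) u \<and> continuous_on (ball 0 1) v \<and>
     visc_sub_Mplus lam Lam s (ball 0 1 \<inter> \<Omega>) (\<lambda>x. u x - C * v x) (\<lambda>x. - 1/2) \<and>
     (\<forall>x\<in>ball 0 1 - \<Omega>. u x = 0 \<and> v x = 0) \<and> (\<forall>x. 0 \<le> u x \<and> 0 \<le> v x) \<and>
     u \<in> borel_measurable lebesgue \<and> v \<in> borel_measurable lebesgue \<and>
     integrable lebesgue (\<lambda>x. u x / (1 + norm x powr p)) \<and>
     integrable lebesgue (\<lambda>x. v x / (1 + norm x powr p)) \<and>
     (LINT x|lebesgue. u x / (1 + norm x powr p)) = 1 \<and>
     (\<forall>x\<in>cball 0 (3/4). u x \<le> C0) \<and> (\<forall>x\<in>cball x0 \<rho>. c0 \<le> v x)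
     \<longrightarrow> (\<forall>z\<in>ball 0 (1/2). u z \<le> C * v z)"
proof -
  have p0: "0 < p" using s by (simp add: p_def add_nonneg_pos)
  have L: "0 < Lam" using lam by simp
  let ?near = "\<lambda>y::'a. indicator (ball 0 (1/8)) y * ((norm y)\<^sup>2 / norm y powr p)"
  define \<nu> where "\<nu> = ?near"
  have inear: "integrable lebesgue \<nu>"
    using integral_singular_kernel_near[OF s, where 'a = 'a] unfolding p_def \<nu>_def by fastforce
  \<comment> \<open>At distance 1/8 from \<open>z\<close> the penalty equals \<open>C0\<close>, so
    \<open>w\<close> is nonpositive in the rest of \<open>cball 0 (3/4)\<close> and its positive
    maximum is attained in \<open>cball z (1/8)\<close>.\<close>
  define K where "K = 64 * C0"
  have K: "0 < K" using C0 by (simp add: K_def)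
  define c8 where "c8 = 2 * (2 / (1/8::real)) powr p"
  have c8: "0 < c8" by (simp add: c8_def)
  define V where "V = unit_ball_vol (DIM('a)) * \<rho> ^ DIM('a)"
  have V: "0 < V" using \<rho> by (simp add: V_def)
  define I where "I = 2 * Lam * K * (LINT y|lebesgue. \<nu> y) + Lam * c8"
  have "0 \<le> (LINT y|lebesgue. \<nu> y)" unfolding \<nu>_def by (intro integral_nonneg_AE) auto
  then have I: "0 \<le> I" using L K c8 unfolding I_def by (intro add_nonneg_nonneg mult_nonneg_nonneg) auto
  \<comment> \<open>The first 2 is the half weight of \<open>m + y\<close> in the second difference;
    \<open>2 powr p\<close> bounds \<open>norm y powr p\<close> when \<open>m + y\<close> lies in
    the ball around \<open>x0\<close>, as both points are in the unit ball.\<close>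
  define \<kappa> where "\<kappa> = lam / 2 / 2 powr p"
  have \<kappa>: "0 < \<kappa>" using lam by (simp add: \<kappa>_def)
  \<comment> \<open>Makes the total integral of the majorant exactly -1, below the right-hand side
    -1/2 of the viscosity inequality.\<close>
  define d where "d = (I + 1) / (\<kappa> * V)"
  have d: "0 < d" using I \<kappa> V by (simp add: d_def)
  have dI: "I - \<kappa> * d * V = -1" using \<kappa> V by (simp add: d_def)
  define C where "C = (d + C0) / c0"
  have C: "0 < C" using d C0 c0 by (simp add: C_def)
  have Cc0: "C * c0 = d + C0" using c0 by (simp add: C_def)
  have "u z \<le> C * v z" if
     \<Omega>: "open \<Omega>" and sub: "ball x0 (2 * \<rho>) \<subseteq> \<Omega> \<inter> ball 0 (1/2)"
     and uc: "continuous_on (ball 0 1) u" and vc: "continuous_on (ball 0 1) v"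
     and visc: "visc_sub_Mplus lam Lam s (ball 0 1 \<inter> \<Omega>) (\<lambda>x. u x - C * v x) (\<lambda>x. - 1/2)"
     and uv0: "\<And>x. x \<in> ball 0 1 - \<Omega> \<Longrightarrow> u x = 0" "\<And>x. x \<in> ball 0 1 - \<Omega> \<Longrightarrow> v x = 0"
     and upos: "\<And>x. 0 \<le> u x" and vpos: "\<And>x. 0 \<le> v x"
     and um: "u \<in> borel_measurable lebesgue" and vm: "v \<in> borel_measurable lebesgue"
     and iu: "integrable lebesgue (\<lambda>x. u x / (1 + norm x powr p))" and iv: "integrable lebesgue (\<lambda>x. v x / (1 + norm x powr p))"
     and iu1: "(LINT x|lebesgue. u x / (1 + norm x powr p)) = 1"
     and uC0: "\<And>x. x \<in> cball 0 (3/4) \<Longrightarrow> u x \<le> C0" and vc0: "\<And>x. x \<in> cball x0 \<rho> \<Longrightarrow> c0 \<le> v x"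
     and z: "z \<in> ball 0 (1/2)"
     for \<Omega> and u v :: "'a \<Rightarrow> real" and x0 z
  proof (rule ccontr)
    assume "\<not> u z \<le> C * v z"
    define \<psi> where "\<psi> y = u y - C * v y" for y
    define w where "w y = \<psi> y - K * (norm (y - z))\<^sup>2" for y
    have wz: "0 < w z" using \<open>\<not> u z \<le> C * v z\<close> by (simp add: w_def \<psi>_def)
    have \<psi>u: "\<psi> y \<le> u y" for y using C vpos[of y] by (simp add: \<psi>_def)
    have \<psi>c: "continuous_on (ball 0 1) \<psi>" unfolding \<psi>_def by (intro continuous_intros uc vc)
    have nz: "norm z < 1/2" using z by simp
    have near_z: "norm y \<le> 5/8" if "y \<in> cball z (1/8)" for y
      using that nz norm_triangle_ineq2[of y z] by (simp add: dist_norm norm_minus_commute)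
    have "cball z (1/8) \<subseteq> ball 0 1" using near_z by force
    then have "continuous_on (cball z (1/8)) w"
      unfolding w_def by (intro continuous_intros continuous_on_subset[OF \<psi>c])
    then obtain m where m: "m \<in> cball z (1/8)" "\<And>y. y \<in> cball z (1/8) \<Longrightarrow> w y \<le> w m"
      using continuous_attains_sup[of "cball z (1/8)" w] by auto
    have wm: "0 < w m" using m(2)[of z] wz by simp
    have nm: "norm m \<le> 5/8" by (rule near_z[OF m(1)])
    have Kw: "0 \<le> K * (norm (y - z))\<^sup>2" for y using K by simp
    have wmax: "w y \<le> w m" if y: "y \<in> cball 0 (3/4)" for y
    proof (cases "y \<in> cball z (1/8)")
      case False
      then have "(1/8)\<^sup>2 \<le> (norm (y - z))\<^sup>2" by (intro power_mono) (auto simp: dist_norm norm_minus_commute)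
      then have "K * (1/8)\<^sup>2 \<le> K * (norm (y - z))\<^sup>2" using K by (intro mult_left_mono) auto
      moreover have "K * (1/8)\<^sup>2 = C0" by (simp add: K_def power2_eq_square)
      ultimately have "w y \<le> 0" using \<psi>u[of y] uC0[OF y] unfolding w_def by linarith
      then show ?thesis using wm by simp
    qed (rule m(2))
    have \<psi>m: "0 < \<psi> m" using wm Kw[of m] unfolding w_def by linarith
    have m01: "m \<in> ball 0 1" using nm by simp
    have "m \<in> \<Omega>"
    proof (rule ccontr)
      assume "m \<notin> \<Omega>"
      then have "\<psi> m = 0" using uv0[of m] m01 by (simp add: \<psi>_def)
      then show False using \<psi>m by simp
    qed
    with m01 have mD: "m \<in> ball 0 1 \<inter> \<Omega>" by simp
    have inner: "\<psi> y \<le> - d" if "y \<in> cball x0 \<rho>" "y \<in> cball 0 (3/4)" for y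
    proof -
      have "C * c0 \<le> C * v y" using vc0[OF that(1)] C by (intro mult_left_mono) auto
      then show ?thesis using uC0[OF that(2)] Cc0 by (simp add: \<psi>_def)
    qed
    have m34: "m \<in> cball 0 (3/4)" using nm by simp
    then have mE: "m \<notin> cball x0 \<rho>" using inner[of m] \<psi>m d by auto
    \<comment> \<open>The test ball must avoid \<open>cball x0 \<rho>\<close>, or the paraboloid
      would overwrite some of the very negative values that give the contradiction. This is possible
      because \<psi> is positive at \<open>m\<close>.\<close>
    have "open ((ball 0 1 \<inter> \<Omega>) - cball x0 \<rho>)" using \<Omega> by auto
    then obtain r0 where r0: "0 < r0" "ball m r0 \<subseteq> (ball 0 1 \<inter> \<Omega>) - cball x0 \<rho>"
      using mD mE by (meson DiffI openE)
    define r where "r = min r0 (1/8)"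
    have r: "0 < r" "r \<le> 1" "r \<le> 1/8" using r0 by (auto simp: r_def)
    have "ball m r \<subseteq> ball m r0" by (auto simp: r_def)
    then have rr: "ball m r \<subseteq> (ball 0 1 \<inter> \<Omega>) - cball x0 \<rho>" using r0(2) by (rule subset_trans)
    then have rD: "ball m r \<subseteq> ball 0 1 \<inter> \<Omega>" and rE: "\<And>y. y \<in> ball m r \<Longrightarrow> y \<notin> cball x0 \<rho>"
      by blast+
    define b where "b = (2 * K) *\<^sub>R (m - z)"
    have expand: "\<psi> m + b \<bullet> (y - m) + K * (norm (y - m))\<^sup>2 = w m + K * (norm (y - z))\<^sup>2" for y
      unfolding b_def w_def power2_norm_eq_inner by (simp add: algebra_simps inner_commute)
    have touch: "\<psi> y \<le> \<psi> m + b \<bullet> (y - m) + K * (norm (y - m))\<^sup>2" if "y \<in> cball 0 (3/4)" for y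
      using wmax[OF that] unfolding expand by (simp add: w_def)
    have small: "m + y \<in> cball 0 (3/4)" "m - y \<in> cball 0 (3/4)" if "norm y < 1/8" for y
      using that nm norm_triangle_ineq[of m y] norm_triangle_ineq4[of m y] by auto
    have m1: "norm m \<le> 1" using nm by simp
    let ?avg = "\<lambda>y. (u (m + y) + u (m - y)) / 2"
    let ?uW = "\<lambda>x. u x / (1 + norm x powr p)"
    define g where "g y = (?uW (m + y) + ?uW (m - y)) / 2" for y
    have g: "integrable lebesgue g" "(LINT y|lebesgue. g y) = 1"
      using integral_symmetric_mean[OF iu, of m] iu1 unfolding g_def by auto
    have g0: "0 \<le> g y" for y using upos by (auto simp: g_def add_nonneg_nonneg)
    have wmean: "1 / norm y powr p * ?avg y \<le> c8 * g y" if "1/8 \<le> norm y" for y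
      using weighted_mean_le[OF p0 m1, of "1/8" u y] upos that by (simp add: c8_def g_def max_absorb1)
    define \<iota> where "\<iota> y = (indicator (ball (x0 - m) \<rho>) y :: real)" for y
    have \<iota>: "\<iota> y = (if m + y \<in> ball x0 \<rho> then 1 else 0)" for y
      by (auto simp: \<iota>_def dist_norm algebra_simps)
    have i\<iota>: "integrable lebesgue \<iota>" "(LINT y|lebesgue. \<iota> y) = V"
      using integral_indicator_ball[of \<rho> "x0 - m"] \<rho> unfolding \<iota>_def V_def by auto
    have half: "ball x0 \<rho> \<subseteq> ball 0 (1/2)" using sub \<rho> by (force simp: subset_iff)
    define G where "G y = 2 * Lam * K * \<nu> y + Lam * (c8 * g y) - \<kappa> * d * \<iota> y" for y
    have G: "G y = 2 * Lam * K * ?near y + Lam * (c8 * g y) - \<kappa> * d * \<iota> y" for y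
      by (simp add: G_def \<nu>_def)
    have iG: "integrable lebesgue G" unfolding G_def
      by (intro Bochner_Integration.integrable_add Bochner_Integration.integrable_diff integrable_mult_right inear i\<iota> g)
    have visc': "visc_sub_Mplus lam Lam s (ball 0 1 \<inter> \<Omega>) \<psi> (\<lambda>x. - 1/2)"
      using visc unfolding \<psi>_def .
    have "- 1/2 \<le> (LINT y|lebesgue. G y)"
    proof (rule visc_sub_paraboloid_test[OF s lam visc' r(1,2) rD m1, where A = "2 * K" and b = b, folded p_def])
      show "0 \<le> 2 * K" using K by simp
      show "\<psi> y < \<psi> m + b \<bullet> (y - m) + 2 * K * (norm (y - m))\<^sup>2" if "y \<in> ball m r" "y \<noteq> m" for y
      proof -
        have "norm (y - m) < 1/8" using that r by (simp add: dist_norm norm_minus_commute)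
        then have "y \<in> cball 0 (3/4)" using small(1)[of "y - m"] by simp
        moreover have "0 < K * (norm (y - m))\<^sup>2" using that K by simp
        ultimately show ?thesis using touch[of y] by simp
      qed
      show "\<psi> \<in> borel_measurable lebesgue" unfolding \<psi>_def using um vm by auto
      have "integrable lebesgue (\<lambda>x. u x / (1 + norm x powr p) - C * (v x / (1 + norm x powr p)))"
        by (intro Bochner_Integration.integrable_diff integrable_mult_right iu iv)
      then show "integrable lebesgue (\<lambda>x. \<psi> x / (1 + norm x powr p))"
        by (simp add: \<psi>_def diff_divide_distrib)
      show "Lam * (2 * K) * ((norm y)\<^sup>2 / norm y powr p) \<le> G y" if y: "y \<noteq> 0" "norm y < r" for y
      proof -
        have "\<iota> y = 0" using rE[of "m + y"] y by (auto simp: \<iota> dist_norm)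
        moreover have "0 \<le> Lam * (c8 * g y)" using L c8 g0[of y] by simp
        ultimately show ?thesis using y r by (simp add: G mult_ac)
      qed
      show "k * sdiff \<psi> m y / norm y powr p \<le> G y" if y: "r \<le> norm y" and k: "lam \<le> k" "k \<le> Lam" for y k
      proof -
        have y0: "0 < norm y" using y r by linarith
        have \<iota>01: "\<iota> y = 0 \<or> \<iota> y = 1" by (simp add: \<iota>)
        \<comment> \<open>Far from \<open>m\<close> the reference value is the average of
          \<open>u\<close> alone, so its integral does not grow with \<open>C\<close>. The terms in
          \<open>v\<close> reappear only in the excess bounded by \<open>gap\<close>.\<close>
        define \<omega> where "\<omega> = (if norm y < 1/8 then K * (norm y)\<^sup>2 else ?avg y)"
        have \<omega>0: "0 \<le> \<omega>" using K upos[of "m + y"] upos[of "m - y"] by (simp add: \<omega>_def)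
        have gap: "\<iota> y * d / 2 \<le> \<omega> - sdiff \<psi> m y"
        proof (cases "norm y < 1/8")
          case True
          \<comment> \<open>By \<open>expand\<close> the paraboloid equals \<open>w m\<close> plus a
            nonnegative penalty, hence is positive, while \<psi> is at most \<open>- d\<close> on
            the ball around \<open>x0\<close>.\<close>
          have 1: "\<iota> y * d \<le> \<psi> m + b \<bullet> y + K * (norm y)\<^sup>2 - \<psi> (m + y)"
          proof (cases "m + y \<in> ball x0 \<rho>")
            case inE: True
            then have "\<psi> (m + y) \<le> - d" using inner[of "m + y"] small(1)[OF True] by auto
            moreover have "0 \<le> \<psi> m + b \<bullet> y + K * (norm y)\<^sup>2"
              using expand[of "m + y"] wm Kw[of "m + y"] by simp
            ultimately show ?thesis using inE by (simp add: \<iota>)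
          next
            case False
            then show ?thesis using touch[OF small(1)[OF True]] by (simp add: \<iota>)
          qed
          have 2: "0 \<le> \<psi> m - b \<bullet> y + K * (norm y)\<^sup>2 - \<psi> (m - y)"
            using touch[OF small(2)[OF True]] by simp
          have "\<omega> - sdiff \<psi> m y = ((\<psi> m + b \<bullet> y + K * (norm y)\<^sup>2 - \<psi> (m + y)) + (\<psi> m - b \<bullet> y + K * (norm y)\<^sup>2 - \<psi> (m - y))) / 2"
            using True by (simp add: \<omega>_def sdiff_def field_simps)
          then show ?thesis using 1 2 by simp
        next
          case False
          have "\<omega> - sdiff \<psi> m y = \<psi> m + (C * v (m + y) + C * v (m - y)) / 2"
            using False by (simp add: \<omega>_def sdiff_def \<psi>_def field_simps)
          moreover have "0 \<le> C * v (m - y)" using C vpos[of "m - y"] by simp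
          moreover have "\<iota> y * d \<le> C * v (m + y)"
          proof (cases "m + y \<in> ball x0 \<rho>")
            case True
            then have "C * c0 \<le> C * v (m + y)" using vc0[of "m + y"] C by (intro mult_left_mono) auto
            then show ?thesis using True Cc0 C0 by (simp add: \<iota>)
          next
            case False
            then show ?thesis using C vpos[of "m + y"] by (simp add: \<iota>)
          qed
          ultimately show ?thesis using \<psi>m unfolding add_divide_distrib by linarith
        qed
        have "k * sdiff \<psi> m y \<le> Lam * \<omega> - lam * (\<omega> - sdiff \<psi> m y)"
          using gap d \<iota>01 by (intro mult_between_le k \<omega>0) auto
        also have "\<dots> \<le> Lam * \<omega> - lam * (\<iota> y * d / 2)"
          using gap lam by (intro diff_left_mono mult_left_mono) auto
        finally have "k * sdiff \<psi> m y / norm y powr p \<le> (Lam * \<omega> - lam * (\<iota> y * d / 2)) / norm y powr p"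
          by (intro divide_right_mono) auto
        also have "\<dots> = Lam * (1 / norm y powr p * \<omega>) - lam * (\<iota> y * d / 2) / norm y powr p"
          by (simp add: diff_divide_distrib)
        also have "\<dots> \<le> (2 * Lam * K * ?near y + Lam * (c8 * g y)) - \<kappa> * d * \<iota> y"
        proof (rule diff_mono)
          show "Lam * (1 / norm y powr p * \<omega>) \<le> 2 * Lam * K * ?near y + Lam * (c8 * g y)"
          proof (cases "norm y < 1/8")
            case True
            have "Lam * (1 / norm y powr p * \<omega>) = Lam * K * ?near y"
              using True by (simp add: \<omega>_def)
            also have "\<dots> \<le> 2 * Lam * K * ?near y" using L K by (intro mult_right_mono) auto
            finally show ?thesis using L c8 g0[of y] by (simp add: add_increasing2)
          next
            case False
            then have "Lam * (1 / norm y powr p * \<omega>) \<le> Lam * (c8 * g y)"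
              using wmean[of y] L by (intro mult_left_mono) (auto simp: \<omega>_def)
            then show ?thesis using False by simp
          qed
          show "\<kappa> * d * \<iota> y \<le> lam * (\<iota> y * d / 2) / norm y powr p"
          proof (cases "m + y \<in> ball x0 \<rho>")
            case True
            then have "norm (m + y) < 1/2" using half by auto
            then have "norm y \<le> 2" using nm norm_triangle_ineq4[of "m + y" m] by simp
            then have "norm y powr p \<le> 2 powr p" using p0 by (intro powr_mono2) auto
            then have "(lam * d / 2) / 2 powr p \<le> (lam * d / 2) / norm y powr p"
              using y0 lam d by (intro divide_left_mono mult_pos_pos) auto
            then show ?thesis using True by (simp add: \<iota> \<kappa>_def)
          qed (simp add: \<iota>)
        qed
        finally show ?thesis unfolding G .
      qed
    qed (use iG in auto)
    also have "(LINT y|lebesgue. G y) = I - \<kappa> * d * V"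
      unfolding G_def I_def using inear i\<iota> g by simp
    finally show False unfolding dI by simp
  qed
  then show ?thesis using C by (intro exI[of _ C]) blast
qed

section \<open>Choice of \<delta> and the two-sided comparison\<close>

theorem theorem1p2:
  fixes s lam Lam \<rho> :: real
  assumes "0 < s" "s < 1" "0 < lam" "lam \<le> Lam" "0 < \<rho>"
  shows "\<exists>\<delta>>0. \<exists>C>0. \<forall>(\<Omega> :: 'a::euclidean_space set) x0 u1 u2.
     open \<Omega> \<and> x0 \<in> ball 0 (1/2) \<and> ball x0 (2 * \<rho>) \<subseteq> \<Omega> \<inter> ball 0 (1/2) \<and>
     continuous_on (ball 0 1) u1 \<and> continuous_on (ball 0 1) u2 \<and>
     (\<forall>a b. visc_sub_Mplus lam Lam s (ball 0 1 \<inter> \<Omega>) (\<lambda>x. a * u1 x + b * u2 x)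
                (\<lambda>x. - \<delta> * (\<bar>a\<bar> + \<bar>b\<bar>))) \<and>
     (\<forall>x\<in>ball 0 1 - \<Omega>. u1 x = 0 \<and> u2 x = 0) \<and>
     (\<forall>x. u1 x \<ge> 0 \<and> u2 x \<ge> 0) \<and>
     u1 \<in> borel_measurable lebesgue \<and> u2 \<in> borel_measurable lebesgue \<and>
     integrable lebesgue (\<lambda>x. u1 x / (1 + norm x powr (real DIM('a) + 2 * s))) \<and>
     integrable lebesgue (\<lambda>x. u2 x / (1 + norm x powr (real DIM('a) + 2 * s))) \<and>
     (LINT x|lebesgue. u1 x / (1 + norm x powr (real DIM('a) + 2 * s))) = 1 \<and>
     (LINT x|lebesgue. u2 x / (1 + norm x powr (real DIM('a) + 2 * s))) = 1
     \<longrightarrow> (\<forall>x\<in>ball 0 (1/2). u2 x / C \<le> u1 x \<and> u1 x \<le> C * u2 x)"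
proof -
  let ?p = "real DIM('a) + 2 * s"
  obtain C0 where C0: "0 < C0" "\<And>\<Omega> (u :: 'a \<Rightarrow> real) \<delta>.
     open \<Omega> \<and> continuous_on (ball 0 1) u \<and> \<delta> \<le> 1 \<and>
     visc_sub_Mplus lam Lam s (ball 0 1 \<inter> \<Omega>) u (\<lambda>x. - \<delta>) \<and>
     (\<forall>x\<in>ball 0 1 - \<Omega>. u x = 0) \<and> (\<forall>x. 0 \<le> u x) \<and> u \<in> borel_measurable lebesgue \<and>
     integrable lebesgue (\<lambda>x. u x / (1 + norm x powr ?p)) \<and>
     (LINT x|lebesgue. u x / (1 + norm x powr ?p)) = 1
     \<Longrightarrow> (\<forall>x\<in>cball 0 (3/4). u x \<le> C0)"
    using subsolution_upper_bound[OF assms(1-4), where 'a = 'a] by blast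
  obtain c0 where c0: "0 < c0" "\<And>\<Omega> (u :: 'a \<Rightarrow> real) x0 \<delta>.
     open \<Omega> \<and> ball x0 (2 * \<rho>) \<subseteq> \<Omega> \<inter> ball 0 (1/2) \<and> continuous_on (ball 0 1) u \<and> \<delta> \<le> c0 \<and>
     visc_sub_Mplus lam Lam s (ball 0 1 \<inter> \<Omega>) (\<lambda>x. - u x) (\<lambda>x. - \<delta>) \<and>
     (\<forall>x. 0 \<le> u x) \<and> u \<in> borel_measurable lebesgue \<and>
     integrable lebesgue (\<lambda>x. u x / (1 + norm x powr ?p)) \<and>
     (LINT x|lebesgue. u x / (1 + norm x powr ?p)) = 1
     \<Longrightarrow> (\<forall>x\<in>cball x0 \<rho>. c0 \<le> u x)"
    using supersolution_lower_bound[OF assms(1-5), where 'a = 'a] by blast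
  obtain C where C: "0 < C" "\<And>\<Omega> (u :: 'a \<Rightarrow> real) v x0.
     open \<Omega> \<and> ball x0 (2 * \<rho>) \<subseteq> \<Omega> \<inter> ball 0 (1/2) \<and>
     continuous_on (ball 0 1) u \<and> continuous_on (ball 0 1) v \<and>
     visc_sub_Mplus lam Lam s (ball 0 1 \<inter> \<Omega>) (\<lambda>x. u x - C * v x) (\<lambda>x. - 1/2) \<and>
     (\<forall>x\<in>ball 0 1 - \<Omega>. u x = 0 \<and> v x = 0) \<and> (\<forall>x. 0 \<le> u x \<and> 0 \<le> v x) \<and>
     u \<in> borel_measurable lebesgue \<and> v \<in> borel_measurable lebesgue \<and>
     integrable lebesgue (\<lambda>x. u x / (1 + norm x powr ?p)) \<and>
     integrable lebesgue (\<lambda>x. v x / (1 + norm x powr ?p)) \<and>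
     (LINT x|lebesgue. u x / (1 + norm x powr ?p)) = 1 \<and>
     (\<forall>x\<in>cball 0 (3/4). u x \<le> C0) \<and> (\<forall>x\<in>cball x0 \<rho>. c0 \<le> v x)
     \<Longrightarrow> (\<forall>z\<in>ball 0 (1/2). u z \<le> C * v z)"
    using quotient_upper_bound[OF assms(1-5) C0(1) c0(1), where 'a = 'a] by blast
  \<comment> \<open>The three bounds serve the upper bound, the lower bound and the comparison: the
    last gives \<open>\<delta> * (1 + C) \<le> 1/2\<close>. There is no circularity, since
    \<open>C0\<close>, \<open>c0\<close> and \<open>C\<close> were obtained without reference to
    \<delta>.\<close>
  define \<delta> where "\<delta> = min (min 1 c0) (1 / (2 * (1 + C)))"
  have \<delta>: "0 < \<delta>" "\<delta> \<le> 1" "\<delta> \<le> c0" using C(1) c0(1) by (auto simp: \<delta>_def)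
  have "\<delta> * (1 + C) \<le> 1 / (2 * (1 + C)) * (1 + C)"
    using C(1) by (intro mult_right_mono) (auto simp: \<delta>_def)
  also have "\<dots> = 1/2"
  proof -
    have "1 / (2 * a) * a = 1/2" if "a \<noteq> 0" for a :: real using that by simp
    from this[of "1 + C"] show ?thesis using C(1) by simp
  qed
  finally have \<delta>C: "\<delta> * (1 + C) \<le> 1/2" .
  have visc_mono: "visc_sub_Mplus lam Lam s D u f" if "visc_sub_Mplus lam Lam s D u f'" "\<And>x. f x \<le> f' x"
    for D and u :: "'a \<Rightarrow> real" and f f'
    using that unfolding visc_sub_Mplus_def by (meson ereal_less_eq(3) order_trans)
  have "u2 x / C \<le> u1 x \<and> u1 x \<le> C * u2 x" if
     \<Omega>: "open \<Omega>" "ball x0 (2 * \<rho>) \<subseteq> \<Omega> \<inter> ball 0 (1/2)"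
     and cont: "continuous_on (ball 0 1) u1" "continuous_on (ball 0 1) u2"
     and visc: "\<forall>a b. visc_sub_Mplus lam Lam s (ball 0 1 \<inter> \<Omega>) (\<lambda>x. a * u1 x + b * u2 x)
                (\<lambda>x. - \<delta> * (\<bar>a\<bar> + \<bar>b\<bar>))"
     and zero: "\<forall>x\<in>ball 0 1 - \<Omega>. u1 x = 0 \<and> u2 x = 0"
     and pos: "\<forall>x. u1 x \<ge> 0 \<and> u2 x \<ge> 0"
     and meas: "u1 \<in> borel_measurable lebesgue" "u2 \<in> borel_measurable lebesgue"
     and int: "integrable lebesgue (\<lambda>x. u1 x / (1 + norm x powr ?p))"
       "integrable lebesgue (\<lambda>x. u2 x / (1 + norm x powr ?p))"
     and one: "(LINT x|lebesgue. u1 x / (1 + norm x powr ?p)) = 1"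
       "(LINT x|lebesgue. u2 x / (1 + norm x powr ?p)) = 1"
     and x: "x \<in> ball 0 (1/2)"
     for \<Omega> and x0 :: 'a and u1 u2 :: "'a \<Rightarrow> real" and x
  proof -
    \<comment> \<open>Coefficients 1 and -1 on a single function say that
      \<open>M\<^sup>+ u \<ge> - \<delta>\<close> and \<open>M\<^sup>- u \<le> \<delta>\<close> for
      each of \<open>u1\<close> and \<open>u2\<close>.\<close>
    have v: "visc_sub_Mplus lam Lam s (ball 0 1 \<inter> \<Omega>) u1 (\<lambda>x. - \<delta>)"
      "visc_sub_Mplus lam Lam s (ball 0 1 \<inter> \<Omega>) u2 (\<lambda>x. - \<delta>)"
      "visc_sub_Mplus lam Lam s (ball 0 1 \<inter> \<Omega>) (\<lambda>x. - u1 x) (\<lambda>x. - \<delta>)"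
      "visc_sub_Mplus lam Lam s (ball 0 1 \<inter> \<Omega>) (\<lambda>x. - u2 x) (\<lambda>x. - \<delta>)"
      using visc[rule_format, of 1 0] visc[rule_format, of 0 1]
        visc[rule_format, of "-1" 0] visc[rule_format, of 0 "-1"] by simp_all
    have half: "- 1/2 \<le> - \<delta> * (\<bar>1\<bar> + \<bar>- C\<bar>)" "- 1/2 \<le> - \<delta> * (\<bar>- C\<bar> + \<bar>1\<bar>)"
      using \<delta>C C(1) by (simp_all add: algebra_simps)
    have v12: "visc_sub_Mplus lam Lam s (ball 0 1 \<inter> \<Omega>) (\<lambda>x. u1 x - C * u2 x) (\<lambda>x. - 1/2)"
      using visc_mono[OF visc[rule_format, of 1 "- C"] half(1)] by simp
    have v21: "visc_sub_Mplus lam Lam s (ball 0 1 \<inter> \<Omega>) (\<lambda>x. u2 x - C * u1 x) (\<lambda>x. - 1/2)"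
      using visc_mono[OF visc[rule_format, of "- C" 1] half(2)] by simp
    have zero': "\<forall>x\<in>ball 0 1 - \<Omega>. u1 x = 0" "\<forall>x\<in>ball 0 1 - \<Omega>. u2 x = 0"
      "\<forall>x\<in>ball 0 1 - \<Omega>. u2 x = 0 \<and> u1 x = 0"
      using zero by auto
    have pos': "\<forall>x. 0 \<le> u1 x" "\<forall>x. 0 \<le> u2 x" "\<forall>x. 0 \<le> u2 x \<and> 0 \<le> u1 x"
      using pos by auto
    have up1: "\<forall>x\<in>cball 0 (3/4). u1 x \<le> C0"
      by (rule C0(2)[of \<Omega> u1 \<delta>], intro conjI) fact+
    have up2: "\<forall>x\<in>cball 0 (3/4). u2 x \<le> C0"
      by (rule C0(2)[of \<Omega> u2 \<delta>], intro conjI) fact+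
    have lo1: "\<forall>x\<in>cball x0 \<rho>. c0 \<le> u1 x"
      by (rule c0(2)[of \<Omega> x0 u1 \<delta>], intro conjI) fact+
    have lo2: "\<forall>x\<in>cball x0 \<rho>. c0 \<le> u2 x"
      by (rule c0(2)[of \<Omega> x0 u2 \<delta>], intro conjI) fact+
    have "\<forall>z\<in>ball 0 (1/2). u1 z \<le> C * u2 z"
      by (rule C(2)[of \<Omega> x0 u1 u2], intro conjI) fact+
    then have "u1 x \<le> C * u2 x" using x by (rule bspec)
    moreover have "\<forall>z\<in>ball 0 (1/2). u2 z \<le> C * u1 z"
      by (rule C(2)[of \<Omega> x0 u2 u1], intro conjI) fact+
    then have "u2 x \<le> C * u1 x" using x by (rule bspec)
    ultimately show ?thesis using C(1) by (simp add: pos_divide_le_eq mult.commute)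
  qed
  note main = this
  show ?thesis
    by (intro exI[of _ \<delta>] exI[of _ C] conjI \<delta>(1) C(1) allI impI, elim conjE, intro ballI, rule main, assumption+)
qed

end
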